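(* Let $\alpha:\mathbb{R}\to\mathbb{R}^+=[0,\infty)$ be a convex symmetric (i.e. even) function of class $C^1$ such that $\alpha(0)=\alpha'(0)=0$ and $\alpha'$ is concave on $\mathbb{R}^+$. Let $c(x)=\sum_{i=1}^k\alpha(x_i)$, $x\in\mathbb{R}^k$, and let $\mu$ be a probability measure on $\mathbb{R}^k$. Assume that $\mu$ verifies $\mathbf{T}_c(C)$ for some $C>0$. Let $\varphi:\mathbb{R}^k\to\mathbb{R}$ be bounded (and measurable) and define $d\tilde\mu(x)=\frac1Z e^{\varphi(x)}\,d\mu(x)$, where $Z$ is the normalization constant. Then $\tilde\mu$ verifies $\mathbf{T}_c(8Ce^{\mathrm{Osc}(\varphi)})$, where $\mathrm{Osc}(\varphi)=\sup\varphi-\inf\varphi$.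
   Context: For probability measures $\nu,\mu$ on $\mathbb{R}^k$, $\mathcal{T}_c(\nu,\mu)=\inf_\pi\iint c(x-y)\,d\pi(x,y)$, where the infimum is over probability measures $\pi$ on $\mathbb{R}^k\times\mathbb{R}^k$ with marginals $\nu$ and $\mu$. $H(\nu|\mu)=\int\log\frac{d\nu}{d\mu}\,d\nu$ if $\nu\ll\mu$ and $+\infty$ otherwise. A probability measure $\mu$ verifies $\mathbf{T}_c(C)$ if $\mathcal{T}_c(\nu,\mu)\le C\,H(\nu|\mu)$ for all probability measures $\nu$ on $\mathbb{R}^k$. *)

theory Defs
  imports "HOL-Probability.Probability"
begin

definition borel_prob :: "('a::euclidean_space) measure \<Rightarrow> bool" where
  "borel_prob \<mu> \<longleftrightarrow> sets \<mu> = sets borel \<and> prob_space \<mu>"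

definition couplings ::
    "('a::euclidean_space) measure \<Rightarrow> 'a measure \<Rightarrow> ('a \<times> 'a) measure set" where
  "couplings \<nu> \<mu> =
     {\<pi>. borel_prob \<pi> \<and> distr \<pi> borel fst = \<nu> \<and> distr \<pi> borel snd = \<mu>}"

text \<open>The costs considered are nonnegative; \<^const>\<open>ennreal\<close> would truncate negative values to 0.\<close>

definition transport_cost ::
    "('a::euclidean_space \<Rightarrow> real) \<Rightarrow> 'a measure \<Rightarrow> 'a measure \<Rightarrow> ennreal" where
  "transport_cost c \<nu> \<mu> =
     (INF \<pi>\<in>couplings \<nu> \<mu>. \<integral>\<^sup>+ z. ennreal (c (fst z - snd z)) \<partial>\<pi>)"

text \<open>
  The integral of the logarithm of the density may be infinite even if \<open>\<nu>\<close> is absolutely continuous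
  with respect to \<open>\<mu>\<close>, so the Bochner integral (which is 0 for non-integrable functions) is unsuitable:
  the integral is taken as the difference of the integrals of the positive and the negative part.
  For probability measures the latter is always finite (at most \<open>1/e\<close>), so the
  difference is never of the form \<open>\<infinity> - \<infinity>\<close>. The values of the density at which
  \<^const>\<open>ln\<close> or \<^const>\<open>enn2real\<close> are conventional, 0 and \<open>\<infinity>\<close>, are taken on a \<open>\<nu>\<close>-null set only.
\<close>

definition relative_entropy :: "'a measure \<Rightarrow> 'a measure \<Rightarrow> ereal" where
  "relative_entropy \<nu> \<mu> =
     (if absolutely_continuous \<mu> \<nu>
      then enn2ereal (\<integral>\<^sup>+ x. ennreal (ln (enn2real (RN_deriv \<mu> \<nu> x))) \<partial>\<nu>)
         - enn2ereal (\<integral>\<^sup>+ x. ennreal (- ln (enn2real (RN_deriv \<mu> \<nu> x))) \<partial>\<nu>)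
      else \<infinity>)"

definition transport_ineq ::
    "('a::euclidean_space \<Rightarrow> real) \<Rightarrow> real \<Rightarrow> 'a measure \<Rightarrow> bool" where
  "transport_ineq c C \<mu> \<longleftrightarrow> borel_prob \<mu> \<and>
     (\<forall>\<nu>. borel_prob \<nu> \<longrightarrow>
        enn2ereal (transport_cost c \<nu> \<mu>) \<le> ereal C * relative_entropy \<nu> \<mu>)"

definition sum_cost :: "(real \<Rightarrow> real) \<Rightarrow> real ^ 'k::finite \<Rightarrow> real" where
  "sum_cost \<alpha> x = (\<Sum>i\<in>UNIV. \<alpha> (x $ i))"

definition exp_tilt :: "('a \<Rightarrow> real) \<Rightarrow> 'a measure \<Rightarrow> 'a measure" where
  "exp_tilt \<phi> \<mu> =
     (let Z = (\<integral>x. exp (\<phi> x) \<partial>\<mu>) in density \<mu> (\<lambda>x. ennreal (exp (\<phi> x) / Z)))"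

definition osc :: "('a \<Rightarrow> real) \<Rightarrow> real" where
  "osc \<phi> = (SUP x. \<phi> x) - (INF x. \<phi> x)"

end

theory Submission
  imports Defs
begin

text \<open>
  Multiplying a density by a bounded factor is harmless for inequalities between integrals of
  nonnegative functions, but the transport inequality is not of this kind. The proof therefore goes
  through one that is: a logarithmic Sobolev inequality in which the gradient
  term is replaced by the defect \<open>f - Q f\<close> of an infimal convolution
  \<open>Q f x = (INF y. f y + \<kappa> * c (x - y))\<close>.

  From transport to this inequality, test the transport inequality on the measure with density
  proportional to \<open>e\<^sup>f\<close> and compare \<open>f x\<close> with \<open>f y\<close> along a nearly optimal coupling
  (\<open>transport_ineq_imp_restricted_lsi\<close>). The new inequality survives a bounded perturbation at the price of
  a factor \<open>E = e\<^bsup>Osc \<phi>\<^esup>\<close> by the argument of Holley and Stroock (\<open>restricted_lsi_exp_tilt\<close>).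

  The way back is a semigroup argument of Hamilton-Jacobi type. For finitely many points \<open>z\<close> with
  heights \<open>h z\<close> let \<open>G\<^sub>\<theta> y\<close> be the maximum of \<open>h z - \<theta> * c (z - y)\<close>. Along a suitable curve \<open>(k, \<theta>)\<close>
  leading from \<open>(1 / (8 C E), 4)\<close> to \<open>(0, 1)\<close> the quantity \<open>ln (\<integral> e\<^bsup>k G\<^sub>\<theta>\<^esup>) / k\<close> is nondecreasing: its
  derivative is the mean increase of \<open>G\<^sub>\<theta>\<close> minus a multiple of an entropy, and the logarithmic Sobolev
  inequality says that the entropy is dominated (\<open>log_laplace_step\<close>, \<open>log_laplace_le_integral\<close>). This works
  because an envelope of translates of the cost cannot decrease quickly: \<open>k G\<^sub>\<theta> - Q (k G\<^sub>\<theta>)\<close> is bounded by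
  a multiple of the cost at the maximising point, which is also the speed at which \<open>G\<^sub>\<theta>\<close> increases as
  \<open>\<theta>\<close> decreases. All steps are finite increments, by convexity of \<open>G\<^sub>\<theta>\<close> in \<open>\<theta>\<close> and of the logarithmic
  Laplace transform.

  By the Donsker-Varadhan inequality the resulting bound says that the Kantorovich dual functional
  between \<open>\<nu>\<close> and the perturbed measure is at most \<open>8 C E\<close> times the relative entropy of \<open>\<nu>\<close>, up to the
  error made by discretising \<open>\<nu>\<close> (\<open>dual_bound\<close>). Duality for a finitely supported first marginal is
  proved by maximising an entropically regularised dual functional (\<open>semidiscrete_duality\<close>); the coupling
  it produces is an explicit density, which undoes the discretisation without disintegration.

  The shape of the cost enters only through \<open>c (x + y) \<le> (1 + 1/\<rho>) * c x + (1 + \<rho>) * c y\<close> for all \<open>\<rho> > 0\<close>,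
  which for a sum of \<open>\<alpha> (x\<^sub>i)\<close> follows from convexity and \<open>\<alpha> (\<sigma> u) \<le> \<sigma>\<^sup>2 \<alpha> u\<close> for \<open>\<sigma> \<ge> 1\<close>; the latter is
  where concavity of the derivative is used.
\<close>

section \<open>Exponential tilts and relative entropy\<close>

lemma integrable_bounded_range:
  fixes f :: "'a \<Rightarrow> real"
  assumes "prob_space M" "f \<in> borel_measurable M" "bounded (range f)"
  shows "integrable M f"
proof -
  interpret prob_space M by fact
  obtain B where "\<And>x. \<bar>f x\<bar> \<le> B"
    using assms(3) by (auto simp: bounded_iff)
  then show ?thesis
    using assms(2) by (intro integrable_const_bound[of _ B]) auto
qed

lemma bounded_range_exp:
  fixes f :: "'a \<Rightarrow> real"
  assumes "bounded (range f)"
  shows "bounded (range (\<lambda>x. exp (f x)))"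
proof -
  obtain B where "\<And>x. \<bar>f x\<bar> \<le> B"
    using assms by (auto simp: bounded_iff)
  then have "\<And>x. norm (exp (f x)) \<le> exp B"
    by (simp add: abs_le_iff)
  then show ?thesis by (auto simp: bounded_iff)
qed

lemma integral_exp_pos:
  fixes f :: "'a \<Rightarrow> real"
  assumes "prob_space M" "integrable M (\<lambda>x. exp (f x))"
  shows "0 < (\<integral>x. exp (f x) \<partial>M)"
proof -
  interpret prob_space M by fact
  have "(\<integral>x. exp (f x) \<partial>M) \<noteq> 0"
    using integral_nonneg_eq_0_iff_AE[OF assms(2)] AE_False by auto
  moreover have "0 \<le> (\<integral>x. exp (f x) \<partial>M)" by simp
  ultimately show ?thesis by linarith
qed

lemma sets_exp_tilt [simp]: "sets (exp_tilt f M) = sets M"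
  by (simp add: exp_tilt_def Let_def)

lemma space_exp_tilt [simp]: "space (exp_tilt f M) = space M"
  by (simp add: exp_tilt_def Let_def)

lemma exp_tilt_integral:
  fixes f g :: "'a \<Rightarrow> real"
  assumes [measurable]: "f \<in> borel_measurable M"
    and [measurable]: "g \<in> borel_measurable M"
  shows "(\<integral>x. g x \<partial>exp_tilt f M) = (\<integral>x. exp (f x) * g x \<partial>M) / (\<integral>x. exp (f x) \<partial>M)"
proof -
  have "(\<integral>x. g x \<partial>exp_tilt f M) = (\<integral>x. exp (f x) / (\<integral>x. exp (f x) \<partial>M) * g x \<partial>M)"
    unfolding exp_tilt_def Let_def by (intro integral_real_density) auto
  then show ?thesis by simp
qed

lemma exp_tilt_integrable:
  fixes f g :: "'a \<Rightarrow> real"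
  assumes [measurable]: "f \<in> borel_measurable M"
    and [measurable]: "g \<in> borel_measurable M"
    and "integrable M (\<lambda>x. exp (f x) * g x)"
  shows "integrable (exp_tilt f M) g"
  unfolding exp_tilt_def Let_def using assms(3)
  by (subst integrable_real_density) auto

lemma prob_space_exp_tilt:
  fixes f :: "'a \<Rightarrow> real"
  assumes "prob_space M" and [measurable]: "f \<in> borel_measurable M"
    and int: "integrable M (\<lambda>x. exp (f x))"
  shows "prob_space (exp_tilt f M)"
proof
  let ?Z = "\<integral>x. exp (f x) \<partial>M"
  have Z: "?Z > 0" using integral_exp_pos[OF assms(1) int] .
  have "emeasure (exp_tilt f M) (space M) = (\<integral>\<^sup>+x. ennreal (exp (f x) / ?Z) \<partial>M)"
    unfolding exp_tilt_def Let_def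
    by (subst emeasure_density) (auto intro!: nn_integral_cong)
  also have "\<dots> = ennreal (\<integral>x. exp (f x) / ?Z \<partial>M)"
    using int Z by (intro nn_integral_eq_integral) auto
  also have "\<dots> = 1" using Z by simp
  finally show "emeasure (exp_tilt f M) (space (exp_tilt f M)) = 1" by simp
qed

lemma integral_le_ln_integral_exp:
  fixes g :: "'a \<Rightarrow> real"
  assumes "prob_space N" "integrable N g" "integrable N (\<lambda>x. exp (g x))"
  shows "(\<integral>x. g x \<partial>N) \<le> ln (\<integral>x. exp (g x) \<partial>N)"
proof -
  interpret prob_space N by fact
  have "exp (\<integral>x. g x \<partial>N) \<le> (\<integral>x. exp (g x) \<partial>N)"
    by (rule jensens_inequality[where I = UNIV]) (use assms exp_convex in auto)
  then show ?thesis
    using integral_exp_pos[OF assms(1,3)] by (simp add: ln_ge_iff)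
qed

text \<open>
  Jensen's inequality under the tilted measure: \<open>\<integral> e\<^sup>g dM\<close> is \<open>\<integral> e\<^sup>f dM\<close> times the mean of
  \<open>e\<^bsup>g - f\<^esup>\<close> under the tilt by \<open>f\<close>. In other words the convex functional
  \<open>g \<mapsto> ln \<integral> e\<^sup>g dM\<close> lies above its tangent at \<open>f\<close>, whose slope is the tilted mean. The inequality is
  exact for finite increments, so no derivative under the integral sign is ever taken.
\<close>

lemma gibbs_tangent:
  fixes f g :: "'a \<Rightarrow> real"
  assumes M: "prob_space M" and [measurable]: "f \<in> borel_measurable M" "g \<in> borel_measurable M"
    and bf: "bounded (range f)" and bg: "bounded (range g)"
  shows "(\<integral>x. g x - f x \<partial>exp_tilt f M) \<le> ln (\<integral>x. exp (g x) \<partial>M) - ln (\<integral>x. exp (f x) \<partial>M)"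
proof -
  note ef = integrable_bounded_range[OF M _ bounded_range_exp[OF bf]]
  note eg = integrable_bounded_range[OF M _ bounded_range_exp[OF bg]]
  have P: "prob_space (exp_tilt f M)"
    by (rule prob_space_exp_tilt) (use M ef in auto)
  have b: "bounded (range (\<lambda>x. g x - f x))"
    using bounded_minus_comp[OF bg bf] by simp
  have "(\<integral>x. g x - f x \<partial>exp_tilt f M) \<le> ln (\<integral>x. exp (g x - f x) \<partial>exp_tilt f M)"
    by (intro integral_le_ln_integral_exp P integrable_bounded_range bounded_range_exp b)
      (simp_all add: exp_tilt_def Let_def)
  also have "(\<integral>x. exp (g x - f x) \<partial>exp_tilt f M) = (\<integral>x. exp (g x) \<partial>M) / (\<integral>x. exp (f x) \<partial>M)"
    by (subst exp_tilt_integral) (auto simp: M mult_exp_exp)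
  also have "ln \<dots> = ln (\<integral>x. exp (g x) \<partial>M) - ln (\<integral>x. exp (f x) \<partial>M)"
    by (intro ln_divide_pos integral_exp_pos M ef eg) auto
  finally show ?thesis .
qed

text \<open>
  The density \<open>q\<close> agrees almost everywhere with the Radon-Nikodym derivative, and integrability of
  \<open>ln q\<close> makes the positive and negative parts of the entropy finite, so that their difference is an
  ordinary integral.
\<close>

lemma relative_entropy_density:
  fixes q :: "'a \<Rightarrow> real"
  assumes M: "prob_space M" and [measurable]: "q \<in> borel_measurable M"
    and q: "\<And>x. 0 \<le> q x"
    and int: "integrable (density M (\<lambda>x. ennreal (q x))) (\<lambda>x. ln (q x))"
  shows "relative_entropy (density M (\<lambda>x. ennreal (q x))) M
      = ereal (\<integral>x. ln (q x) \<partial>density M (\<lambda>x. ennreal (q x)))"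
proof -
  interpret prob_space M by fact
  let ?N = "density M (\<lambda>x. ennreal (q x))"
  have ac: "absolutely_continuous M ?N"
    by (rule absolutely_continuousI_density) simp
  have "AE x in M. ennreal (q x) = RN_deriv M ?N x"
    by (rule RN_deriv_unique) auto
  then have "AE x in ?N. ennreal (q x) = RN_deriv M ?N x"
    using absolutely_continuous_AE[OF _ ac] by (metis sets_density)
  then have eq: "AE x in ?N. enn2real (RN_deriv M ?N x) = q x"
    by eventually_elim (metis q enn2real_ennreal)
  have pos: "(\<integral>\<^sup>+ x. ennreal (ln (enn2real (RN_deriv M ?N x))) \<partial>?N) = (\<integral>\<^sup>+ x. ennreal (ln (q x)) \<partial>?N)"
    by (rule nn_integral_cong_AE) (use eq in eventually_elim, simp)
  have neg: "(\<integral>\<^sup>+ x. ennreal (- ln (enn2real (RN_deriv M ?N x))) \<partial>?N) = (\<integral>\<^sup>+ x. ennreal (- ln (q x)) \<partial>?N)"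
    by (rule nn_integral_cong_AE) (use eq in eventually_elim, simp)
  have fin: "(\<integral>\<^sup>+ x. ennreal (ln (q x)) \<partial>?N) \<noteq> \<infinity>" "(\<integral>\<^sup>+ x. ennreal (- ln (q x)) \<partial>?N) \<noteq> \<infinity>"
    using int unfolding real_integrable_def by auto
  show ?thesis
    unfolding relative_entropy_def pos neg real_lebesgue_integral_def[OF int] using ac fin
    by (cases rule: ennreal2_cases[of "\<integral>\<^sup>+ x. ennreal (ln (q x)) \<partial>?N" "\<integral>\<^sup>+ x. ennreal (- ln (q x)) \<partial>?N"])
      auto
qed

text \<open>
  Finiteness of the entropy only constrains the positive part of \<open>ln q\<close> directly; the negative part
  is integrable in any case because \<open>- q ln q \<le> 1\<close>. Together they make \<open>ln q\<close> integrable, so finite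
  entropies can be handled as real integrals.
\<close>

lemma finite_relative_entropyE:
  assumes M: "prob_space M" and N: "prob_space N" and sets: "sets N = sets M"
    and fin: "relative_entropy N M \<noteq> \<infinity>"
  obtains q :: "'a \<Rightarrow> real" where "q \<in> borel_measurable M" "\<And>x. 0 \<le> q x"
    "N = density M (\<lambda>x. ennreal (q x))" "integrable N (\<lambda>x. ln (q x))"
    "relative_entropy N M = ereal (\<integral>x. ln (q x) \<partial>N)"
proof -
  interpret prob_space M by fact
  interpret N: prob_space N by fact
  have ac: "absolutely_continuous M N"
    using fin by (auto simp: relative_entropy_def split: if_splits)
  define q where "q x = enn2real (RN_deriv M N x)" for x
  have q_meas [measurable]: "q \<in> borel_measurable M" unfolding q_def by measurable
  have q0: "0 \<le> q x" for x by (simp add: q_def)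
  have "AE x in M. RN_deriv M N x \<noteq> \<infinity>"
    by (rule RN_deriv_finite) (use ac sets N.sigma_finite_measure_axioms in auto)
  then have eq: "AE x in M. RN_deriv M N x = ennreal (q x)"
    by eventually_elim (auto simp: q_def less_top)
  have dens: "N = density M (\<lambda>x. ennreal (q x))"
    by (subst density_RN_deriv[OF ac sets, symmetric], rule density_cong) (use eq in auto)
  have [measurable]: "q \<in> borel_measurable N"
    using q_meas sets measurable_cong_sets by blast
  \<comment> \<open>The negative part of the entropy is bounded by \<open>\<integral> 1/q dN \<le> 1\<close>.\<close>
  have "(\<integral>\<^sup>+ x. ennreal (- ln (q x)) \<partial>N) = (\<integral>\<^sup>+ x. ennreal (q x) * ennreal (- ln (q x)) \<partial>M)"
    by (subst dens, subst nn_integral_density) auto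
  also have "\<dots> \<le> (\<integral>\<^sup>+ x. 1 \<partial>M)"
  proof (rule nn_integral_mono)
    fix x
    show "ennreal (q x) * ennreal (- ln (q x)) \<le> 1"
    proof (cases "q x = 0")
      case False
      then have pos: "0 < q x" using q0[of x] by simp
      have "- ln (q x) \<le> 1 / q x"
        using ln_le_minus_one[of "1 / q x"] pos by (simp add: ln_div)
      then have "q x * (- ln (q x)) \<le> 1" using pos by (simp add: field_simps)
      then show ?thesis
        by (subst ennreal_mult'[symmetric]) (use pos in auto)
    qed simp
  qed
  also have "\<dots> = 1" by (simp add: emeasure_space_1)
  finally have neg: "(\<integral>\<^sup>+ x. ennreal (- ln (q x)) \<partial>N) \<le> 1" .
  have "(\<integral>\<^sup>+ x. ennreal (ln (q x)) \<partial>N) \<noteq> \<infinity>"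
  proof
    assume "(\<integral>\<^sup>+ x. ennreal (ln (q x)) \<partial>N) = \<infinity>"
    then have "relative_entropy N M = \<infinity> - enn2ereal (\<integral>\<^sup>+ x. ennreal (- ln (q x)) \<partial>N)"
      using ac by (simp add: relative_entropy_def q_def)
    with neg fin show False
      by (cases rule: ennreal_cases[of "\<integral>\<^sup>+ x. ennreal (- ln (q x)) \<partial>N"]) auto
  qed
  with neg have int: "integrable N (\<lambda>x. ln (q x))"
    unfolding real_integrable_def by (auto simp: top_unique)
  show thesis
  proof (rule that)
    show "relative_entropy N M = ereal (\<integral>x. ln (q x) \<partial>N)"
      using relative_entropy_density[OF M q_meas q0] int dens by metis
  qed (use q_meas q0 dens int in auto)
qed

lemma relative_entropy_exp_tilt:
  fixes f :: "'a \<Rightarrow> real"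
  assumes M: "prob_space M" and [measurable]: "f \<in> borel_measurable M"
    and int: "integrable M (\<lambda>x. exp (f x))" and intf: "integrable M (\<lambda>x. exp (f x) * f x)"
  shows "relative_entropy (exp_tilt f M) M
    = ereal ((\<integral>x. f x \<partial>exp_tilt f M) - ln (\<integral>x. exp (f x) \<partial>M))"
proof -
  let ?Z = "\<integral>x. exp (f x) \<partial>M"
  have Z: "?Z > 0" using integral_exp_pos[OF M int] .
  interpret N: prob_space "exp_tilt f M" by (rule prob_space_exp_tilt[OF M _ int]) simp
  have eq: "exp_tilt f M = density M (\<lambda>x. ennreal (exp (f x) / ?Z))"
    by (simp add: exp_tilt_def)
  have ln: "ln (exp (f x) / ?Z) = f x - ln ?Z" for x
    using Z by (simp add: ln_div)
  have f: "integrable (exp_tilt f M) f"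
    by (rule exp_tilt_integrable[OF _ _ intf]) auto
  have "relative_entropy (exp_tilt f M) M = ereal (\<integral>x. ln (exp (f x) / ?Z) \<partial>exp_tilt f M)"
    unfolding eq by (rule relative_entropy_density[OF M])
      (use Z f in \<open>auto simp: ln eq[symmetric]\<close>)
  also have "(\<integral>x. ln (exp (f x) / ?Z) \<partial>exp_tilt f M) = (\<integral>x. f x \<partial>exp_tilt f M) - ln ?Z"
    unfolding ln using f N.prob_space by simp
  finally show ?thesis .
qed

text \<open>
  With \<open>q\<close> the density of \<open>N\<close> and \<open>Z = \<integral> e\<^sup>g dM\<close>, apply \<open>ln t \<le> t - 1\<close> to \<open>t = e\<^sup>g / (q Z)\<close> and integrate
  against \<open>N\<close>: the right-hand side integrates to at most \<open>0\<close>.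
\<close>

lemma donsker_varadhan:
  fixes g :: "'a \<Rightarrow> real"
  assumes M: "prob_space M" and N: "prob_space N" and sets: "sets N = sets M"
    and [measurable]: "g \<in> borel_measurable M" and bg: "bounded (range g)"
    and H: "relative_entropy N M = ereal H"
  shows "(\<integral>x. g x \<partial>N) \<le> H + ln (\<integral>x. exp (g x) \<partial>M)"
proof -
  interpret N: prob_space N by fact
  from H have fin: "relative_entropy N M \<noteq> \<infinity>" by simp
  obtain q :: "'a \<Rightarrow> real" where [measurable]: "q \<in> borel_measurable M" and q0: "\<And>x. 0 \<le> q x"
    and dens: "N = density M (\<lambda>x. ennreal (q x))" and int: "integrable N (\<lambda>x. ln (q x))"
    and HE: "relative_entropy N M = ereal (\<integral>x. ln (q x) \<partial>N)"
    using finite_relative_entropyE[OF M N sets fin] by blast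
  have H': "H = (\<integral>x. ln (q x) \<partial>N)" using H HE by simp
  have eg: "integrable M (\<lambda>x. exp (g x))"
    by (intro integrable_bounded_range[OF M] bounded_range_exp bg) simp
  let ?Z = "\<integral>x. exp (g x) \<partial>M"
  have Z: "?Z > 0" using integral_exp_pos[OF M eg] .
  have gN: "integrable N g"
    by (rule integrable_bounded_range[OF N _ bg]) (simp add: dens)
  have lnq: "integrable M (\<lambda>x. q x * (g x - ln (q x) - ln ?Z))"
  proof -
    have "integrable N (\<lambda>x. g x - ln (q x) - ln ?Z)" using gN int by simp
    then show ?thesis
      unfolding dens by (subst (asm) integrable_real_density) (use q0 in auto)
  qed
  have "(\<integral>x. g x - ln (q x) - ln ?Z \<partial>N) = (\<integral>x. q x * (g x - ln (q x) - ln ?Z) \<partial>M)"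
    unfolding dens by (intro integral_real_density) (use q0 in auto)
  also have "\<dots> \<le> (\<integral>x. exp (g x) / ?Z - q x \<partial>M)"
  proof (intro integral_mono lnq)
    have "integrable N (\<lambda>x. 1::real)" by simp
    then have qi: "integrable M q"
      unfolding dens by (subst (asm) integrable_real_density) (use q0 in auto)
    then show "integrable M (\<lambda>x. exp (g x) / ?Z - q x)" using eg by simp
    fix x
    show "q x * (g x - ln (q x) - ln ?Z) \<le> exp (g x) / ?Z - q x"
    proof (cases "q x = 0")
      case False
      then have pos: "0 < q x" using q0[of x] by simp
      have "g x - ln (q x) - ln ?Z = ln (exp (g x) / (q x * ?Z))"
        using pos Z by (simp add: ln_div ln_mult)
      also have "\<dots> \<le> exp (g x) / (q x * ?Z) - 1"
        by (rule ln_le_minus_one) (use pos Z in auto)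
      finally have "q x * (g x - ln (q x) - ln ?Z) \<le> q x * (exp (g x) / (q x * ?Z) - 1)"
        using pos by simp
      also have "\<dots> = exp (g x) / ?Z - q x" using pos by (simp add: field_simps)
      finally show ?thesis .
    qed (use Z in simp)
  qed
  also have "\<dots> = 0"
  proof -
    have "integrable N (\<lambda>x. 1::real)" by simp
    moreover have "(\<integral>x. 1 \<partial>N) = (\<integral>x. q x * 1 \<partial>M)"
      unfolding dens by (intro integral_real_density) (use q0 in auto)
    moreover have "integrable M (\<lambda>x. q x * 1)"
      using \<open>integrable N (\<lambda>x. 1::real)\<close> unfolding dens
      by (subst (asm) integrable_real_density) (use q0 in auto)
    ultimately show ?thesis using eg Z by (simp add: N.prob_space)
  qed
  finally show ?thesis
    using gN int H' by (simp add: N.prob_space)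
qed

section \<open>From the transport inequality to a restricted logarithmic Sobolev inequality\<close>

lemma bounded_range_mult:
  fixes f g :: "'a \<Rightarrow> real"
  assumes "bounded (range f)" "bounded (range g)"
  shows "bounded (range (\<lambda>x. f x * g x))"
proof -
  obtain A B where "\<And>x. \<bar>f x\<bar> \<le> A" "\<And>x. \<bar>g x\<bar> \<le> B"
    using assms by (auto simp: bounded_iff)
  then have "\<And>x. norm (f x * g x) \<le> A * B"
    by (auto simp: abs_mult intro!: mult_mono intro: order_trans[OF abs_ge_zero])
  then show ?thesis by (auto simp: bounded_iff)
qed

lemma borel_measurable_fst_snd [measurable]:
  "(fst :: 'a::euclidean_space \<times> 'a \<Rightarrow> 'a) \<in> borel_measurable borel"
  "(snd :: 'a::euclidean_space \<times> 'a \<Rightarrow> 'a) \<in> borel_measurable borel"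
  by (intro borel_measurable_continuous_onI continuous_intros)+

lemma coupling_fst:
  fixes g :: "'a::euclidean_space \<Rightarrow> real"
  assumes "\<pi> \<in> couplings \<nu> \<mu>" and [measurable]: "g \<in> borel_measurable borel"
  shows "(\<integral>z. g (fst z) \<partial>\<pi>) = (\<integral>x. g x \<partial>\<nu>)"
    and "integrable \<pi> (\<lambda>z. g (fst z)) \<longleftrightarrow> integrable \<nu> g"
proof -
  have eq: "distr \<pi> borel fst = \<nu>" and sets: "sets \<pi> = sets borel"
    using assms(1) by (auto simp: couplings_def borel_prob_def)
  have [measurable]: "fst \<in> measurable \<pi> borel"
    by (simp add: measurable_cong_sets[OF sets refl])
  show "(\<integral>z. g (fst z) \<partial>\<pi>) = (\<integral>x. g x \<partial>\<nu>)"
    unfolding eq[symmetric] by (subst integral_distr) auto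
  show "integrable \<pi> (\<lambda>z. g (fst z)) \<longleftrightarrow> integrable \<nu> g"
    unfolding eq[symmetric] by (subst integrable_distr_eq) auto
qed

lemma coupling_snd:
  fixes g :: "'a::euclidean_space \<Rightarrow> real"
  assumes "\<pi> \<in> couplings \<nu> \<mu>" and [measurable]: "g \<in> borel_measurable borel"
  shows "(\<integral>z. g (snd z) \<partial>\<pi>) = (\<integral>x. g x \<partial>\<mu>)"
    and "integrable \<pi> (\<lambda>z. g (snd z)) \<longleftrightarrow> integrable \<mu> g"
proof -
  have eq: "distr \<pi> borel snd = \<mu>" and sets: "sets \<pi> = sets borel"
    using assms(1) by (auto simp: couplings_def borel_prob_def)
  have [measurable]: "snd \<in> measurable \<pi> borel"
    by (simp add: measurable_cong_sets[OF sets refl])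
  show "(\<integral>z. g (snd z) \<partial>\<pi>) = (\<integral>x. g x \<partial>\<mu>)"
    unfolding eq[symmetric] by (subst integral_distr) auto
  show "integrable \<pi> (\<lambda>z. g (snd z)) \<longleftrightarrow> integrable \<mu> g"
    unfolding eq[symmetric] by (subst integrable_distr_eq) auto
qed

text \<open>
  The transport cost is an infimum that need not be attained, hence the slack \<open>e\<close>.
\<close>

lemma transport_ineq_coupling:
  fixes c :: "'a::euclidean_space \<Rightarrow> real"
  assumes T: "transport_ineq c C \<mu>" and \<nu>: "borel_prob \<nu>"
    and [measurable]: "c \<in> borel_measurable borel" and c0: "\<And>x. 0 \<le> c x"
    and H: "relative_entropy \<nu> \<mu> = ereal H" and e: "0 < e"
  obtains \<pi> where "\<pi> \<in> couplings \<nu> \<mu>" "integrable \<pi> (\<lambda>z. c (fst z - snd z))"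
    "(\<integral>z. c (fst z - snd z) \<partial>\<pi>) \<le> C * H + e"
proof -
  have T': "enn2ereal (transport_cost c \<nu> \<mu>) \<le> ereal (C * H)"
    using T \<nu> H by (auto simp: transport_ineq_def)
  moreover have "0 \<le> enn2ereal (transport_cost c \<nu> \<mu>)" by simp
  ultimately have CH: "0 \<le> C * H" by (metis ereal_less_eq(5) order_trans)
  have "transport_cost c \<nu> \<mu> \<le> ennreal (C * H)"
    using T' CH by (metis enn2ereal_ennreal less_eq_ennreal.rep_eq)
  also have "\<dots> < ennreal (C * H + e)"
    using CH e by (simp add: ennreal_less_iff)
  finally have "\<exists>\<pi>\<in>couplings \<nu> \<mu>. (\<integral>\<^sup>+ z. ennreal (c (fst z - snd z)) \<partial>\<pi>) < ennreal (C * H + e)"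
    unfolding transport_cost_def by (subst (asm) INF_less_iff) auto
  then obtain \<pi> where \<pi>: "\<pi> \<in> couplings \<nu> \<mu>"
    and less: "(\<integral>\<^sup>+ z. ennreal (c (fst z - snd z)) \<partial>\<pi>) < ennreal (C * H + e)" by auto
  have sets: "sets \<pi> = sets borel"
    using \<pi> by (auto simp: couplings_def borel_prob_def)
  have [measurable]: "(\<lambda>z. c (fst z - snd z)) \<in> borel_measurable \<pi>"
    by (simp add: measurable_cong_sets[OF sets refl])
  have int: "integrable \<pi> (\<lambda>z. c (fst z - snd z))"
    using less c0 by (intro integrableI_nonneg) (auto intro: less_trans[OF _ ennreal_less_top])
  have "ennreal (\<integral>z. c (fst z - snd z) \<partial>\<pi>) < ennreal (C * H + e)"
    using less c0 by (subst nn_integral_eq_integral[symmetric, OF int]) auto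
  then have "(\<integral>z. c (fst z - snd z) \<partial>\<pi>) \<le> C * H + e"
    using CH e c0 by (subst (asm) ennreal_less_iff) (auto intro!: integral_nonneg_AE)
  with \<pi> int show thesis by (rule that)
qed

text \<open>
  The smallest \<open>w\<close> admissible for \<open>f\<close> is \<open>f - Q f\<close> with the infimal convolution
  \<open>Q f x = (INF y. f y + \<kappa> * c (x - y))\<close>, and the left-hand side of the inequality is the relative entropy of
  the tilt of \<open>M\<close> by \<open>f\<close>. Quantifying over measurable upper bounds \<open>w\<close> avoids the question whether \<open>Q f\<close>
  is measurable. For the quadratic cost and smooth \<open>f\<close> with small second derivatives, \<open>f - Q f\<close> is
  comparable to \<open>\<bar>\<nabla>f\<bar>\<^sup>2\<close>, which is why this is a form of the logarithmic Sobolev inequality.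
\<close>

definition restricted_lsi :: "('a::euclidean_space \<Rightarrow> real) \<Rightarrow> real \<Rightarrow> real \<Rightarrow> 'a measure \<Rightarrow> bool" where
  "restricted_lsi c \<kappa> K M \<longleftrightarrow>
    (\<forall>f w. f \<in> borel_measurable borel \<longrightarrow> w \<in> borel_measurable borel \<longrightarrow>
      bounded (range f) \<longrightarrow> bounded (range w) \<longrightarrow>
      (\<forall>x y. f x - f y \<le> w x + \<kappa> * c (x - y)) \<longrightarrow>
      (\<integral>x. f x \<partial>exp_tilt f M) - ln (\<integral>x. exp (f x) \<partial>M) \<le> K * (\<integral>x. w x \<partial>exp_tilt f M))"

text \<open>
  Let \<open>\<nu>\<close> be the tilt of \<open>\<mu>\<close> by \<open>f\<close>. By Jensen its entropy \<open>H\<close> is at most \<open>\<integral>f d\<nu> - \<integral>f d\<mu>\<close>. Along a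
  coupling this is the mean of \<open>f x - f y \<le> w x + \<kappa> * c (x - y)\<close>, and for a nearly optimal coupling the
  mean cost is at most \<open>C * H\<close>. So \<open>H \<le> \<integral>w d\<nu> + \<kappa> * C * H\<close>, and the last term can be absorbed.
\<close>

lemma transport_ineq_imp_restricted_lsi:
  fixes c :: "'a::euclidean_space \<Rightarrow> real"
  assumes T: "transport_ineq c C \<mu>"
    and [measurable]: "c \<in> borel_measurable borel" and c0: "\<And>x. 0 \<le> c x"
    and \<kappa>: "0 \<le> \<kappa>" "\<kappa> * C < 1"
  shows "restricted_lsi c \<kappa> (1 / (1 - \<kappa> * C)) \<mu>"
  unfolding restricted_lsi_def
proof (intro allI impI)
  fix f w :: "'a \<Rightarrow> real"
  assume [measurable]: "f \<in> borel_measurable borel" "w \<in> borel_measurable borel"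
    and bf: "bounded (range f)" and bw: "bounded (range w)"
    and fw: "\<forall>x y. f x - f y \<le> w x + \<kappa> * c (x - y)"
  have P: "prob_space \<mu>" and sets: "sets \<mu> = sets borel"
    using T by (auto simp: transport_ineq_def borel_prob_def)
  note meas = measurable_cong_sets[OF sets refl]
  have [measurable]: "f \<in> borel_measurable \<mu>" "w \<in> borel_measurable \<mu>"
    by (simp_all add: meas)
  note ef = integrable_bounded_range[OF P _ bounded_range_exp[OF bf]]
  have iff: "integrable \<mu> f" by (rule integrable_bounded_range[OF P _ bf]) simp
  let ?\<nu> = "exp_tilt f \<mu>"
  have \<nu>: "prob_space ?\<nu>" by (rule prob_space_exp_tilt[OF P]) (use ef in auto)
  then have b\<nu>: "borel_prob ?\<nu>" by (simp add: borel_prob_def sets)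
  have f\<nu>: "integrable ?\<nu> f" and w\<nu>: "integrable ?\<nu> w"
    using integrable_bounded_range[OF \<nu> _ bf] integrable_bounded_range[OF \<nu> _ bw]
    by (simp_all add: exp_tilt_def Let_def)
  define H where "H = (\<integral>x. f x \<partial>?\<nu>) - ln (\<integral>x. exp (f x) \<partial>\<mu>)"
  have "integrable \<mu> (\<lambda>x. exp (f x) * f x)"
    by (rule integrable_bounded_range[OF P])
      (use bounded_range_mult[OF bounded_range_exp[OF bf] bf] in auto)
  then have H: "relative_entropy ?\<nu> \<mu> = ereal H"
    unfolding H_def by (intro relative_entropy_exp_tilt P ef) auto
  have mean: "(\<integral>x. f x \<partial>\<mu>) \<le> ln (\<integral>x. exp (f x) \<partial>\<mu>)"
    by (intro integral_le_ln_integral_exp P iff ef) auto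
  have "H \<le> (\<integral>x. w x \<partial>?\<nu>) + \<kappa> * (C * H + e)" if e: "0 < e" for e
  proof -
    obtain \<pi> where \<pi>: "\<pi> \<in> couplings ?\<nu> \<mu>" and ic: "integrable \<pi> (\<lambda>z. c (fst z - snd z))"
      and le: "(\<integral>z. c (fst z - snd z) \<partial>\<pi>) \<le> C * H + e"
      by (rule transport_ineq_coupling[OF T b\<nu> _ c0 H e]) auto
    have i: "integrable \<pi> (\<lambda>z. f (fst z))" "integrable \<pi> (\<lambda>z. f (snd z))" "integrable \<pi> (\<lambda>z. w (fst z))"
      using coupling_fst(2)[OF \<pi>, of f] coupling_fst(2)[OF \<pi>, of w] coupling_snd(2)[OF \<pi>, of f]
        f\<nu> w\<nu> iff by auto
    have "H \<le> (\<integral>x. f x \<partial>?\<nu>) - (\<integral>x. f x \<partial>\<mu>)" using mean by (simp add: H_def)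
    also have "\<dots> = (\<integral>z. f (fst z) - f (snd z) \<partial>\<pi>)"
      using i by (simp add: coupling_fst(1)[OF \<pi>] coupling_snd(1)[OF \<pi>])
    also have "\<dots> \<le> (\<integral>z. w (fst z) + \<kappa> * c (fst z - snd z) \<partial>\<pi>)"
      using i ic fw by (intro integral_mono) auto
    also have "\<dots> = (\<integral>x. w x \<partial>?\<nu>) + \<kappa> * (\<integral>z. c (fst z - snd z) \<partial>\<pi>)"
      using i ic by (simp add: coupling_fst(1)[OF \<pi>])
    also have "\<dots> \<le> (\<integral>x. w x \<partial>?\<nu>) + \<kappa> * (C * H + e)"
      using le \<kappa> by (intro add_left_mono mult_left_mono) auto
    finally show ?thesis .
  qed
  note H_le = this
  have "(1 - \<kappa> * C) * H \<le> (\<integral>x. w x \<partial>?\<nu>) + e" if e: "0 < e" for e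
  proof -
    define W where "W = (\<integral>x. w x \<partial>?\<nu>)"
    have pos: "0 < e / (\<kappa> + 1)" using e \<kappa> by simp
    have "(1 - \<kappa> * C) * H \<le> W + \<kappa> * (e / (\<kappa> + 1))"
      using H_le[OF pos] unfolding W_def[symmetric] by (simp only: ring_distribs mult.assoc)
    also have "\<kappa> * (e / (\<kappa> + 1)) \<le> e" using e \<kappa> by (simp add: field_simps)
    finally show ?thesis unfolding W_def by simp
  qed
  then have "(1 - \<kappa> * C) * H \<le> (\<integral>x. w x \<partial>?\<nu>)"
    by (rule field_le_epsilon)
  then have "H \<le> 1 / (1 - \<kappa> * C) * (\<integral>x. w x \<partial>?\<nu>)"
    using \<kappa> by (simp add: pos_le_divide_eq mult.commute)
  then show "(\<integral>x. f x \<partial>?\<nu>) - ln (\<integral>x. exp (f x) \<partial>\<mu>) \<le> 1 / (1 - \<kappa> * C) * (\<integral>x. w x \<partial>?\<nu>)"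
    by (simp add: H_def)
qed

section \<open>Bounded perturbations\<close>

lemma osc_bounds:
  assumes "bounded (range \<phi>)"
  shows "(INF x. \<phi> x) \<le> \<phi> x" "\<phi> x \<le> (SUP x. \<phi> x)" "0 \<le> osc \<phi>"
proof -
  have "bdd_below (range \<phi>)" "bdd_above (range \<phi>)"
    using assms by (auto simp: bounded_imp_bdd_below bounded_imp_bdd_above)
  then show *: "(INF x. \<phi> x) \<le> \<phi> x" "\<phi> x \<le> (SUP x. \<phi> x)" for x
    by (auto intro: cINF_lower cSUP_upper)
  from *(1)[of undefined] *(2)[of undefined] show "0 \<le> osc \<phi>" by (simp add: osc_def)
qed

text \<open>
  The unnormalised entropy of \<open>e\<^sup>f\<close> is a minimum over \<open>t > 0\<close>, attained at \<open>t = Z\<close>. The point of this form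
  is that for each \<open>t\<close> the integrand is nonnegative, so that it can be compared under a change of measure.
\<close>

lemma entropy_variational:
  fixes f :: "'a \<Rightarrow> real"
  assumes M: "prob_space M" and [measurable]: "f \<in> borel_measurable M" and bf: "bounded (range f)"
    and t: "0 < t"
  defines "Z \<equiv> \<integral>x. exp (f x) \<partial>M"
  defines "A \<equiv> \<integral>x. f x * exp (f x) - exp (f x) * ln t - exp (f x) + t \<partial>M"
  shows "Z * ((\<integral>x. f x \<partial>exp_tilt f M) - ln Z) \<le> A" (is "?lhs \<le> _")
    and "t = Z \<Longrightarrow> Z * ((\<integral>x. f x \<partial>exp_tilt f M) - ln Z) = A"
proof -
  interpret prob_space M by fact
  note ef = integrable_bounded_range[OF M _ bounded_range_exp[OF bf]]
  have Z: "0 < Z" unfolding Z_def by (intro integral_exp_pos M ef) simp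
  have i: "integrable M (\<lambda>x. f x * exp (f x))"
    by (rule integrable_bounded_range[OF M])
      (use bounded_range_mult[OF bf bounded_range_exp[OF bf]] in auto)
  have e: "integrable M (\<lambda>x. exp (f x))" by (rule ef) simp
  have l: "?lhs = (\<integral>x. f x * exp (f x) \<partial>M) - Z * ln Z"
    using Z by (subst exp_tilt_integral) (auto simp: Z_def[symmetric] algebra_simps)
  have r: "A = (\<integral>x. f x * exp (f x) \<partial>M) - Z * ln t - Z + t"
    using i e by (simp add: A_def Z_def prob_space)
  have "Z * (ln t - ln Z) \<le> Z * (t / Z - 1)"
    using ln_le_minus_one[of "t / Z"] t Z by (intro mult_left_mono) (auto simp: ln_div)
  also have "\<dots> = t - Z" using Z by (simp add: field_simps)
  finally show "?lhs \<le> A" unfolding l r by (simp add: algebra_simps)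
  show "t = Z \<Longrightarrow> ?lhs = A" unfolding l r by simp
qed

text \<open>
  The perturbation argument of Holley and Stroock. The entropy with respect to the perturbed measure
  is at most the integral of the nonnegative function \<open>g\<close> taken at \<open>t = \<integral> e\<^sup>f d\<mu>\<close>; replacing \<open>e\<^sup>\<phi>\<close> by its
  supremum there costs one factor, and replacing it by its infimum in the integral of \<open>w e\<^sup>f\<close>, which is
  nonnegative as well, costs the other. The normalisation of the perturbed measure cancels.
\<close>

lemma restricted_lsi_exp_tilt:
  fixes c :: "'a::euclidean_space \<Rightarrow> real"
  assumes L: "restricted_lsi c \<kappa> K \<mu>" and \<mu>: "borel_prob \<mu>" and K: "0 \<le> K" and c0: "c 0 = 0"
    and [measurable]: "\<phi> \<in> borel_measurable borel" and b\<phi>: "bounded (range \<phi>)"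
  shows "restricted_lsi c \<kappa> (K * exp (osc \<phi>)) (exp_tilt \<phi> \<mu>)"
  unfolding restricted_lsi_def
proof (intro allI impI)
  fix f w :: "'a \<Rightarrow> real"
  assume [measurable]: "f \<in> borel_measurable borel" "w \<in> borel_measurable borel"
    and bf: "bounded (range f)" and bw: "bounded (range w)"
    and fw: "\<forall>x y. f x - f y \<le> w x + \<kappa> * c (x - y)"
  have w0: "0 \<le> w x" for x using fw[rule_format, of x x] c0 by simp
  have P: "prob_space \<mu>" and sets: "sets \<mu> = sets borel"
    using \<mu> by (auto simp: borel_prob_def)
  let ?M = "exp_tilt \<phi> \<mu>"
  have [measurable]: "f \<in> borel_measurable \<mu>" "w \<in> borel_measurable \<mu>" "\<phi> \<in> borel_measurable \<mu>"
    by (simp_all add: measurable_cong_sets[OF sets refl])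
  have [measurable]: "f \<in> borel_measurable ?M" "w \<in> borel_measurable ?M"
    by (simp_all add: measurable_cong_sets[OF trans[OF sets_exp_tilt sets] refl])
  have e\<phi>: "integrable \<mu> (\<lambda>x. exp (\<phi> x))"
    by (intro integrable_bounded_range[OF P] bounded_range_exp b\<phi>) simp
  have PM: "prob_space ?M" by (rule prob_space_exp_tilt[OF P _ e\<phi>]) simp
  let ?V = "\<integral>x. exp (\<phi> x) \<partial>\<mu>"
  have V: "0 < ?V" by (rule integral_exp_pos[OF P e\<phi>])
  let ?Z = "\<integral>x. exp (f x) \<partial>\<mu>" and ?Z' = "\<integral>x. exp (f x) \<partial>?M"
  have Z: "0 < ?Z" "0 < ?Z'"
    by (intro integral_exp_pos P PM integrable_bounded_range bounded_range_exp bf; simp)+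
  let ?a = "INF x. \<phi> x" and ?b = "SUP x. \<phi> x"
  \<comment> \<open>The entropy integrand at the minimiser \<open>t = ?Z\<close> for the unperturbed measure.\<close>
  define g where "g x = f x * exp (f x) - exp (f x) * ln ?Z - exp (f x) + ?Z" for x
  have [measurable]: "g \<in> borel_measurable \<mu>" unfolding g_def by simp
  have bg: "bounded (range g)"
    unfolding g_def by (intro bounded_plus_comp bounded_minus_comp bounded_range_mult bounded_range_exp bf) auto
  have g0: "0 \<le> g x" for x
  proof -
    have "1 + (ln ?Z - f x) \<le> exp (ln ?Z - f x)" by (rule exp_ge_add_one_self)
    then have "exp (f x) * (1 + (ln ?Z - f x)) \<le> exp (f x) * exp (ln ?Z - f x)" by simp
    also have "\<dots> = ?Z" using Z by (simp add: mult_exp_exp)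
    finally show ?thesis by (simp add: g_def algebra_simps)
  qed
  have iw: "integrable \<mu> (\<lambda>x. w x * exp (f x))" "integrable \<mu> (\<lambda>x. exp (\<phi> x) * (w x * exp (f x)))"
    by (intro integrable_bounded_range[OF P] bounded_range_mult bounded_range_exp bf bw b\<phi>; simp)+
  have ig: "integrable \<mu> g" "integrable \<mu> (\<lambda>x. exp (\<phi> x) * g x)"
    by (intro integrable_bounded_range[OF P] bounded_range_mult bounded_range_exp bg b\<phi>; simp)+
  have "?Z' * ((\<integral>x. f x \<partial>exp_tilt f ?M) - ln ?Z') \<le> (\<integral>x. g x \<partial>?M)"
    unfolding g_def by (rule entropy_variational(1)[OF PM _ bf Z(1)]) simp
  also have "\<dots> = (\<integral>x. exp (\<phi> x) * g x \<partial>\<mu>) / ?V"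
    by (rule exp_tilt_integral) auto
  also have "\<dots> \<le> (\<integral>x. exp ?b * g x \<partial>\<mu>) / ?V"
    using V ig g0 osc_bounds[OF b\<phi>] by (intro divide_right_mono integral_mono mult_right_mono) auto
  also have "\<dots> = exp ?b * (\<integral>x. g x \<partial>\<mu>) / ?V" by simp
  also have "(\<integral>x. g x \<partial>\<mu>) = ?Z * ((\<integral>x. f x \<partial>exp_tilt f \<mu>) - ln ?Z)"
    unfolding g_def by (rule entropy_variational(2)[OF P _ bf Z(1), symmetric]) auto
  also have "\<dots> \<le> ?Z * (K * (\<integral>x. w x \<partial>exp_tilt f \<mu>))"
    using L fw bf bw Z by (intro mult_left_mono) (auto simp: restricted_lsi_def)
  also have "\<dots> = K * (\<integral>x. w x * exp (f x) \<partial>\<mu>)"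
    using Z by (subst exp_tilt_integral) (auto simp: mult.commute)
  also have "exp ?b * (K * (\<integral>x. w x * exp (f x) \<partial>\<mu>)) / ?V
      = K * exp (osc \<phi>) * ((\<integral>x. exp ?a * (w x * exp (f x)) \<partial>\<mu>) / ?V)"
    by (simp add: osc_def exp_diff)
  also have "\<dots> \<le> K * exp (osc \<phi>) * ((\<integral>x. exp (\<phi> x) * (w x * exp (f x)) \<partial>\<mu>) / ?V)"
    using V iw w0 K osc_bounds[OF b\<phi>]
    by (intro divide_right_mono integral_mono mult_left_mono mult_right_mono) auto
  also have "(\<integral>x. exp (\<phi> x) * (w x * exp (f x)) \<partial>\<mu>) / ?V = (\<integral>x. w x * exp (f x) \<partial>?M)"
    by (rule exp_tilt_integral[symmetric]) auto
  also have "(\<integral>x. w x * exp (f x) \<partial>?M) = ?Z' * (\<integral>x. w x \<partial>exp_tilt f ?M)"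
    using Z by (subst exp_tilt_integral) (auto simp: mult.commute)
  finally have "?Z' * ((\<integral>x. f x \<partial>exp_tilt f ?M) - ln ?Z')
      \<le> ?Z' * (K * exp (osc \<phi>) * (\<integral>x. w x \<partial>exp_tilt f ?M))"
    using V Z K by (simp add: divide_right_mono mult_left_mono algebra_simps)
  then show "(\<integral>x. f x \<partial>exp_tilt f ?M) - ln ?Z' \<le> K * exp (osc \<phi>) * (\<integral>x. w x \<partial>exp_tilt f ?M)"
    using Z by simp
qed

section \<open>Costs of quadratic type and their envelopes\<close>

text \<open>
  The splitting inequality with a free parameter \<open>\<rho>\<close> is all that is retained of the quadratic growth
  of the cost. For \<open>c x = \<bar>x\<bar>\<^sup>2\<close>, optimising over \<open>\<rho>\<close> gives back the triangle inequality for the norm.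
\<close>

locale quad_cost =
  fixes c :: "'a::euclidean_space \<Rightarrow> real"
  assumes cost_cont: "continuous_on UNIV c"
    and cost_nonneg: "0 \<le> c x"
    and cost_zero: "c 0 = 0"
    and cost_minus: "c (- x) = c x"
    and cost_split: "0 < \<rho> \<Longrightarrow> c (x + y) \<le> (1 + 1 / \<rho>) * c x + (1 + \<rho>) * c y"
begin

lemma cost_measurable [measurable]: "c \<in> borel_measurable borel"
  by (rule borel_measurable_continuous_onI[OF cost_cont])

end

text \<open>
  The basic example is \<open>b i y = c (z\<^sub>i - y)\<close> for finitely many points \<open>z\<^sub>i\<close>. The extra index \<open>i\<^sub>0\<close> with
  vanishing cost truncates the envelope below at height \<open>h i\<^sub>0\<close>. It satisfies the same splitting
  inequality, so the truncation needs no separate treatment, and it makes all envelopes bounded.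
\<close>

locale cost_family = quad_cost c
  for c :: "'a::euclidean_space \<Rightarrow> real" +
  fixes I :: "'i set" and h :: "'i \<Rightarrow> real" and b :: "'i \<Rightarrow> 'a \<Rightarrow> real" and i\<^sub>0 :: 'i
  assumes fin: "finite I" and i\<^sub>0: "i\<^sub>0 \<in> I" and b_i\<^sub>0: "b i\<^sub>0 x = 0"
    and b_meas [measurable]: "i \<in> I \<Longrightarrow> b i \<in> borel_measurable borel"
    and b_nonneg: "i \<in> I \<Longrightarrow> 0 \<le> b i x"
    and b_split: "i \<in> I \<Longrightarrow> 0 < \<rho> \<Longrightarrow> b i y \<le> (1 + 1 / \<rho>) * b i x + (1 + \<rho>) * c (x - y)"
begin

definition env :: "real \<Rightarrow> 'a \<Rightarrow> real" where
  "env \<theta> y = Max ((\<lambda>i. h i - \<theta> * b i y) ` I)"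

definition spread :: real where
  "spread = Max (h ` I) - h i\<^sub>0"

lemma env_ge: "i \<in> I \<Longrightarrow> h i - \<theta> * b i y \<le> env \<theta> y"
  unfolding env_def using fin by (intro Max_ge) auto

lemma env_attained: obtains i where "i \<in> I" "env \<theta> y = h i - \<theta> * b i y"
proof -
  have "env \<theta> y \<in> (\<lambda>i. h i - \<theta> * b i y) ` I"
    unfolding env_def using fin i\<^sub>0 by (intro Max_in) auto
  then show thesis using that by auto
qed

lemma env_measurable [measurable]: "env \<theta> \<in> borel_measurable borel"
  unfolding env_def[abs_def] using fin by (intro borel_measurable_Max) auto

lemma env_lower: "h i\<^sub>0 \<le> env \<theta> y"
  using env_ge[OF i\<^sub>0, of \<theta> y] by (simp add: b_i\<^sub>0)

lemma env_upper: "0 \<le> \<theta> \<Longrightarrow> env \<theta> y \<le> Max (h ` I)"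
proof -
  assume \<theta>: "0 \<le> \<theta>"
  obtain i where i: "i \<in> I" "env \<theta> y = h i - \<theta> * b i y" by (rule env_attained)
  have "h i \<le> Max (h ` I)" using i fin by simp
  moreover have "0 \<le> \<theta> * b i y" using \<theta> b_nonneg i by simp
  ultimately show ?thesis using i by linarith
qed

lemma env_bounded: "0 \<le> \<theta> \<Longrightarrow> bounded (range (env \<theta>))"
  using env_lower[of \<theta>] env_upper[of \<theta>]
  by (intro bounded_subset[OF bounded_closed_interval[of "h i\<^sub>0" "Max (h ` I)"]]) auto

lemma spread_nonneg: "0 \<le> spread"
  using order_trans[OF env_lower env_upper, of 0] by (simp add: spread_def)

text \<open>
  As a function of \<open>\<theta>\<close> the envelope is convex with slope \<open>- b i y\<close> for any maximising index \<open>i\<close>. This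
  tangent inequality lets a difference of envelopes stand for the cost at the maximiser, so no
  measurable selection of a maximiser is required.
\<close>

lemma env_diff_ge:
  assumes "\<theta>' \<le> \<theta>" "i \<in> I" "env \<theta> y = h i - \<theta> * b i y"
  shows "(\<theta> - \<theta>') * b i y \<le> env \<theta>' y - env \<theta> y"
  using env_ge[OF assms(2), of \<theta>' y] assms(3) by (simp add: algebra_simps)

lemma env_antimono: "\<theta>' \<le> \<theta> \<Longrightarrow> env \<theta> y \<le> env \<theta>' y"
proof -
  assume le: "\<theta>' \<le> \<theta>"
  obtain i where i: "i \<in> I" "env \<theta> y = h i - \<theta> * b i y" by (rule env_attained)
  from env_diff_ge[OF le i] have "(\<theta> - \<theta>') * b i y \<le> env \<theta>' y - env \<theta> y" .
  moreover have "0 \<le> (\<theta> - \<theta>') * b i y" using le b_nonneg[OF i(1)] by simp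
  ultimately show ?thesis by linarith
qed

lemma env_diff_le:
  assumes "1 \<le> \<theta>'" "\<theta>' \<le> \<theta>"
  shows "env \<theta>' y - env \<theta> y \<le> (\<theta> - \<theta>') * spread"
proof -
  obtain i where i: "i \<in> I" "env \<theta>' y = h i - \<theta>' * b i y" by (rule env_attained)
  have "1 * b i y \<le> \<theta>' * b i y"
    using assms b_nonneg[OF i(1)] by (intro mult_right_mono) auto
  also have "\<theta>' * b i y = h i - env \<theta>' y" using i by simp
  also have "\<dots> \<le> spread"
    unfolding spread_def using env_lower[of \<theta>' y] fin i by (intro diff_mono) auto
  finally have "(\<theta> - \<theta>') * b i y \<le> (\<theta> - \<theta>') * spread"
    using assms by (intro mult_left_mono) auto
  moreover have "env \<theta>' y - env \<theta> y \<le> (\<theta> - \<theta>') * b i y"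
    using env_ge[OF i(1), of \<theta> y] i(2) by (simp add: algebra_simps)
  ultimately show ?thesis by linarith
qed

text \<open>
  If \<open>i\<close> is maximal at \<open>x\<close>, the left-hand side is at most \<open>k * \<theta> * (b i y - b i x)\<close>. The splitting
  inequality bounds \<open>b i y\<close> by \<open>(1 + 1/\<rho>) * b i x + (1 + \<rho>) * c (x - y)\<close>, and \<open>\<rho>\<close> is chosen so that the
  last coefficient becomes exactly \<open>\<kappa>\<close>.
\<close>

lemma env_variation:
  assumes "0 < k" "0 < \<theta>" "\<theta>' < \<theta>" "k * \<theta> < \<kappa>"
  shows "k * env \<theta> x - k * env \<theta> y
    \<le> (k * \<theta>)\<^sup>2 / (\<kappa> - k * \<theta>) * ((env \<theta>' x - env \<theta> x) / (\<theta> - \<theta>')) + \<kappa> * c (x - y)"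
proof -
  define \<rho> where "\<rho> = \<kappa> / (k * \<theta>) - 1"
  have k\<theta>: "0 < k * \<theta>" using assms by simp
  have \<rho>: "0 < \<rho>" "k * \<theta> * (1 + \<rho>) = \<kappa>" "k * \<theta> / \<rho> = (k * \<theta>)\<^sup>2 / (\<kappa> - k * \<theta>)"
    using k\<theta> assms by (auto simp: \<rho>_def field_simps power2_eq_square)
  obtain i where i: "i \<in> I" "env \<theta> x = h i - \<theta> * b i x" by (rule env_attained)
  have "k * env \<theta> x - k * env \<theta> y \<le> k * env \<theta> x - k * (h i - \<theta> * b i y)"
    using env_ge[OF i(1), of \<theta> y] assms by simp
  also have "\<dots> = k * \<theta> * (b i y - b i x)" unfolding i(2) by (simp add: algebra_simps)
  also have "\<dots> \<le> k * \<theta> * (b i x / \<rho> + (1 + \<rho>) * c (x - y))"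
    using b_split[OF i(1) \<rho>(1), of y x] k\<theta> by (intro mult_left_mono) (auto simp: algebra_simps)
  also have "\<dots> = k * \<theta> / \<rho> * b i x + (k * \<theta> * (1 + \<rho>)) * c (x - y)" by (simp add: algebra_simps)
  also have "\<dots> \<le> k * \<theta> / \<rho> * ((env \<theta>' x - env \<theta> x) / (\<theta> - \<theta>')) + \<kappa> * c (x - y)"
    unfolding \<rho>(2) using env_diff_ge[of \<theta>' \<theta> i x] i assms k\<theta> \<rho>(1)
    by (intro add_right_mono mult_left_mono) (auto simp: field_simps)
  finally show ?thesis unfolding \<rho>(3) .
qed

section \<open>Monotonicity along the flow of envelopes\<close>

definition log_laplace :: "'a measure \<Rightarrow> real \<Rightarrow> real \<Rightarrow> real" where
  "log_laplace M k \<theta> = ln (\<integral>x. exp (k * env \<theta> x) \<partial>M) / k"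

text \<open>
  Passing from \<open>(k, \<theta>)\<close> to \<open>(k', \<theta>')\<close> has two effects: raising the envelope gains its mean increment
  \<open>J\<close> under the tilted measure, while lowering \<open>k\<close> loses \<open>1/k' - 1/k\<close> times the entropy of that measure.
  The restricted logarithmic Sobolev inequality, applied with the bound \<open>w\<close> from \<open>env_variation\<close>,
  estimates the entropy by a multiple of \<open>J\<close>.
\<close>

lemma log_laplace_step:
  assumes M: "borel_prob M" and L: "restricted_lsi c \<kappa> K M" and K: "0 \<le> K"
    and k: "0 < k'" "k' \<le> k" and \<theta>: "1 \<le> \<theta>'" "\<theta>' < \<theta>" and k\<theta>: "k * \<theta> < \<kappa>"
  obtains J where "0 \<le> J" "J \<le> (\<theta> - \<theta>') * spread"
    "J * (1 - (1 / k' - 1 / k) * K * (k * \<theta>)\<^sup>2 / ((\<kappa> - k * \<theta>) * (\<theta> - \<theta>')))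
      \<le> log_laplace M k' \<theta>' - log_laplace M k \<theta>"
proof -
  have P: "prob_space M" and sets: "sets M = sets borel"
    using M by (auto simp: borel_prob_def)
  have meas [measurable]: "env t \<in> borel_measurable M" for t
    by (simp add: measurable_cong_sets[OF sets refl])
  let ?f = "\<lambda>x. k * env \<theta> x" and ?g = "\<lambda>x. k' * env \<theta>' x"
  have bd: "bounded (range (env \<theta>))" "bounded (range (env \<theta>'))"
    using \<theta> by (intro env_bounded; simp)+
  have bf: "bounded (range ?f)" "bounded (range ?g)"
    using bounded_range_mult[OF _ bd(1), of "\<lambda>_. k"] bounded_range_mult[OF _ bd(2), of "\<lambda>_. k'"]
    by auto
  let ?N = "exp_tilt ?f M"
  have PN: "prob_space ?N"
    by (intro prob_space_exp_tilt P integrable_bounded_range bounded_range_exp bf) auto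
  then interpret N: prob_space ?N .
  have measN [measurable]: "env t \<in> borel_measurable ?N" for t
    by (simp add: measurable_cong_sets[OF trans[OF sets_exp_tilt sets] refl])
  have i: "integrable ?N (env \<theta>)" "integrable ?N (env \<theta>')"
    by (intro integrable_bounded_range PN bd; simp)+
  define J where "J = (\<integral>x. env \<theta>' x - env \<theta> x \<partial>?N)"
  have J0: "0 \<le> J" unfolding J_def using env_antimono[of \<theta>' \<theta>] \<theta> by simp
  have "J \<le> (\<integral>x. (\<theta> - \<theta>') * spread \<partial>?N)"
    unfolding J_def using i \<theta> env_diff_le by (intro integral_mono) auto
  then have J1: "J \<le> (\<theta> - \<theta>') * spread" using N.prob_space by simp
  define m where "m = (\<integral>x. env \<theta> x \<partial>?N)"
  define A where "A = ln (\<integral>x. exp (?f x) \<partial>M)"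
  define A' where "A' = ln (\<integral>x. exp (?g x) \<partial>M)"
  have m': "(\<integral>x. env \<theta>' x \<partial>?N) = J + m" using i by (simp add: J_def m_def)
  have "(\<integral>x. ?g x - ?f x \<partial>?N) \<le> A' - A"
    unfolding A_def A'_def by (intro gibbs_tangent P bf) auto
  also have "(\<integral>x. ?g x - ?f x \<partial>?N) = k' * (J + m) - k * m"
    using i by (simp add: m' m_def)
  finally have gibbs: "k' * (J + m) - k * m \<le> A' - A" .
  \<comment> \<open>The entropy of the tilted measure is controlled by the increment of the envelope.\<close>
  define R where "R = (k * \<theta>)\<^sup>2 / (\<kappa> - k * \<theta>)"
  let ?w = "\<lambda>x. R * ((env \<theta>' x - env \<theta> x) / (\<theta> - \<theta>'))"
  have "bounded (range ?w)"
    using bounded_range_mult[OF _ bounded_minus_comp[OF bd(2,1)], of "\<lambda>_. R / (\<theta> - \<theta>')"] by simp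
  moreover have "?f x - ?f y \<le> ?w x + \<kappa> * c (x - y)" for x y
    unfolding R_def using k \<theta> k\<theta> by (intro env_variation) auto
  ultimately have "(\<integral>x. ?f x \<partial>?N) - ln (\<integral>x. exp (?f x) \<partial>M) \<le> K * (\<integral>x. ?w x \<partial>?N)"
    using bf by (intro L[unfolded restricted_lsi_def, rule_format]) auto
  then have ent: "k * m - A \<le> K * (R * (J / (\<theta> - \<theta>')))"
    by (simp add: m_def A_def J_def)
  have kk: "0 \<le> 1 / k' - 1 / k" using k by (simp add: frac_le)
  have "J * (1 - (1 / k' - 1 / k) * K * (k * \<theta>)\<^sup>2 / ((\<kappa> - k * \<theta>) * (\<theta> - \<theta>')))
      = J - (1 / k' - 1 / k) * (K * (R * (J / (\<theta> - \<theta>'))))"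
    by (simp add: R_def algebra_simps)
  also have "\<dots> \<le> J - (1 / k' - 1 / k) * (k * m - A)"
    using mult_left_mono[OF ent kk] by simp
  also have "\<dots> = (k' * (J + m) - k * m) / k' + A / k' - A / k"
    using k by (simp add: field_simps)
  also have "\<dots> \<le> (A' - A) / k' + A / k' - A / k"
    using gibbs k by (simp add: divide_right_mono)
  also have "\<dots> = A' / k' - A / k" by (simp add: diff_divide_distrib)
  also have "\<dots> = log_laplace M k' \<theta>' - log_laplace M k \<theta>"
    by (simp add: log_laplace_def A_def A'_def)
  finally show thesis using that[OF J0 J1] by blast
qed

text \<open>
  As \<open>k\<close> tends to \<open>0\<close>, the functional \<open>ln \<integral> e\<^bsup>kG\<^esup> / k\<close> tends to the mean of \<open>G\<close>; this is the quantitative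
  form, from \<open>e\<^sup>u \<le> 1 / (1 - u) \<le> 1 + u + 2 u\<^sup>2\<close> for \<open>u \<le> 1/2\<close>.
\<close>

lemma log_laplace_le_mean:
  assumes M: "borel_prob M" and k: "0 < k" and \<theta>: "1 \<le> \<theta>"
    and B: "\<And>x. \<bar>env 1 x\<bar> \<le> B" and kB: "k * B \<le> 1 / 2"
  shows "log_laplace M k \<theta> \<le> (\<integral>x. env 1 x \<partial>M) + 2 * k * B\<^sup>2"
proof -
  have P: "prob_space M" and sets: "sets M = sets borel"
    using M by (auto simp: borel_prob_def)
  interpret prob_space M by fact
  have meas [measurable]: "env t \<in> borel_measurable M" for t
    by (simp add: measurable_cong_sets[OF sets refl])
  have bd: "0 \<le> t \<Longrightarrow> bounded (range (\<lambda>x. k * env t x))" for t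
    using bounded_range_mult[OF _ env_bounded, of "\<lambda>_. k"] by auto
  have i: "1 \<le> t \<Longrightarrow> integrable M (\<lambda>x. exp (k * env t x))" for t
    by (intro integrable_bounded_range[OF P] bounded_range_exp bd) auto
  have i1: "integrable M (env 1)" by (intro integrable_bounded_range[OF P] env_bounded) auto
  have pw: "exp (k * env \<theta> x) \<le> 1 + k * env 1 x + 2 * (k * B)\<^sup>2" for x
  proof -
    define u where "u = k * env 1 x"
    have absu: "\<bar>u\<bar> \<le> k * B" unfolding u_def abs_mult using B[of x] k by simp
    then have u: "u \<le> 1 / 2" using kB by linarith
    have "exp (k * env \<theta> x) \<le> exp u" unfolding u_def using k env_antimono[OF \<theta>] by simp
    also have "\<dots> \<le> 1 / (1 - u)"
      using exp_ge_add_one_self[of "- u"] u by (simp add: exp_minus field_simps)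
    also have "\<dots> \<le> 1 + u + 2 * u\<^sup>2"
    proof -
      have "(1 + u + 2 * u\<^sup>2) * (1 - u) = 1 + u\<^sup>2 * (1 - 2 * u)"
        by (simp add: algebra_simps power2_eq_square)
      moreover have "0 \<le> u\<^sup>2 * (1 - 2 * u)" using u by (intro mult_nonneg_nonneg) auto
      ultimately show ?thesis using u by (simp add: pos_divide_le_eq)
    qed
    also have "u\<^sup>2 \<le> (k * B)\<^sup>2" using absu by (metis abs_ge_zero power2_abs power_mono)
    finally show ?thesis by (simp add: u_def)
  qed
  have pos: "0 < (\<integral>x. exp (k * env \<theta> x) \<partial>M)" by (intro integral_exp_pos P i \<theta>)
  then have "ln (\<integral>x. exp (k * env \<theta> x) \<partial>M) \<le> (\<integral>x. exp (k * env \<theta> x) \<partial>M) - 1"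
    by (rule ln_le_minus_one)
  also have "(\<integral>x. exp (k * env \<theta> x) \<partial>M) \<le> (\<integral>x. 1 + k * env 1 x + 2 * (k * B)\<^sup>2 \<partial>M)"
    using i[OF \<theta>] i1 pw by (intro integral_mono) auto
  also have "\<dots> = 1 + k * (\<integral>x. env 1 x \<partial>M) + 2 * (k * B)\<^sup>2"
    using i1 by (simp add: prob_space)
  finally have "ln (\<integral>x. exp (k * env \<theta> x) \<partial>M) \<le> k * ((\<integral>x. env 1 x \<partial>M) + 2 * k * B\<^sup>2)"
    by (simp add: power2_eq_square algebra_simps)
  then show ?thesis unfolding log_laplace_def using k by (simp add: pos_divide_le_eq mult.commute)
qed

end

text \<open>
  Divide the interval into \<open>n\<close> equal parts: the total defect is at most \<open>L (b - a)\<^sup>2 / n\<close>. This takes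
  the place of the sign of a derivative.
\<close>

lemma mono_of_quadratic_defect:
  fixes \<Phi> :: "real \<Rightarrow> real"
  assumes ab: "a \<le> b"
    and step: "\<And>x y. a \<le> x \<Longrightarrow> x < y \<Longrightarrow> y \<le> b \<Longrightarrow> - L * (y - x)\<^sup>2 \<le> \<Phi> y - \<Phi> x"
  shows "\<Phi> a \<le> \<Phi> b"
proof (cases "a = b")
  case False
  then have ab: "a < b" using ab by simp
  have main: "- (L * (b - a)\<^sup>2) / real n \<le> \<Phi> b - \<Phi> a" if n: "n > 0" for n
  proof -
    define x where "x j = a + real j * ((b - a) / real n)" for j
    have "(\<Sum>j<n. - L * ((b - a) / real n)\<^sup>2) \<le> (\<Sum>j<n. \<Phi> (x (Suc j)) - \<Phi> (x j))"
    proof (rule sum_mono)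
      fix j assume "j \<in> {..<n}"
      then have "real (Suc j) \<le> real n" by (simp only: of_nat_le_iff) simp
      then have "real (Suc j) * ((b - a) / real n) \<le> real n * ((b - a) / real n)"
        using ab n by (intro mult_right_mono) auto
      then have "x (Suc j) \<le> b" using n by (simp add: x_def)
      moreover have "a \<le> x j" using ab n by (simp add: x_def)
      moreover have d: "x (Suc j) - x j = (b - a) / real n" unfolding x_def of_nat_Suc by (simp only: ring_distribs)
      moreover have "0 < (b - a) / real n" using ab n by simp
      ultimately show "- L * ((b - a) / real n)\<^sup>2 \<le> \<Phi> (x (Suc j)) - \<Phi> (x j)"
        using step[of "x j" "x (Suc j)"] by simp
    qed
    also have "\<dots> = \<Phi> (x n) - \<Phi> (x 0)" by (rule sum_lessThan_telescope)
    also have "x n = b" using n by (simp add: x_def)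
    also have "x 0 = a" by (simp add: x_def)
    finally show ?thesis using n by (simp add: power_divide power2_eq_square)
  qed
  have "(\<lambda>n. - (L * (b - a)\<^sup>2) / real n) \<longlonglongrightarrow> 0"
    by (intro tendsto_divide_0[OF tendsto_const] filterlim_at_top_imp_at_infinity filterlim_real_sequentially)
  then have "0 \<le> \<Phi> b - \<Phi> a"
    by (rule LIMSEQ_le_const2) (use main in \<open>auto intro: exI[of _ 1]\<close>)
  then show ?thesis by simp
qed simp

text \<open>
  The curve \<open>k = s (1 - s) / (2 C E)\<close>, \<open>\<theta> = 1/s\<^sup>2\<close> is the one along which gain and loss in a step balance
  to first order when \<open>E = 1\<close>: in terms of \<open>t = 1/\<theta>\<close> the balance is the linear equation
  \<open>dp/dt = p / (2 t) - 1/4\<close> for \<open>p = C k\<close>, whose solution vanishing at \<open>t = 1\<close> is \<open>p = (\<surd>t - t) / 2\<close>. Larger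
  \<open>E\<close> only helps. The largest value of \<open>k\<close>, attained at \<open>s = 1/2\<close>, is \<open>1 / (8 C E)\<close>, and this is the
  origin of the constant \<open>8\<close>. The estimate says that the ratio of loss to gain exceeds \<open>1\<close> by at most a
  multiple of the step length, uniformly away from \<open>s = 1/2\<close> and \<open>s = 1\<close>.
\<close>

lemma step_coefficient:
  fixes s s' :: real
  assumes s: "1/2 < a" "a \<le> s" "s < s'" "s' \<le> b" "b < 1" and E: "1 \<le> E" and C: "0 < C"
  defines "k \<equiv> \<lambda>s. s * (1 - s) / (2 * C * E)"
    and "\<Lambda> \<equiv> 1 / (2 * a - 1) + 1 / (1 - b)"
  shows "(1 / k s' - 1 / k s) * (2 * E) * (k s * (1 / s\<^sup>2))\<^sup>2
      / ((1 / (2 * C) - k s * (1 / s\<^sup>2)) * (1 / s\<^sup>2 - 1 / s'\<^sup>2)) \<le> 1 + 7 * \<Lambda> ^ 3 * (s' - s)"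
    (is "?X \<le> _")
    and "k s * (1 / s\<^sup>2) < 1 / (2 * C)"
    and "k s' \<le> k s"
proof -
  have p: "0 < s" "0 < s'" "0 < 1 - s" "0 < 1 - s'" "0 < 2 * s - 1" "0 < s + s' - 1" "0 < s' - s"
    using s by auto
  have ks: "k s * (1 / s\<^sup>2) = (1 - s) / (2 * s * C * E)"
    using p by (simp add: k_def power2_eq_square)
  have sE: "0 < s * E - (1 - s)"
    using p E mult_left_mono[of 1 E s] by linarith
  have e2: "1 / (2 * C) - (1 - s) / (2 * s * C * E) = (s * E - (1 - s)) / (2 * s * C * E)"
    using p C E by (simp add: field_simps)
  have "0 < (s * E - (1 - s)) / (2 * s * C * E)"
    using p C E sE by (intro divide_pos_pos) auto
  then show "k s * (1 / s\<^sup>2) < 1 / (2 * C)"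
    unfolding ks using e2 by linarith
  have "0 < (s' - s) * (s + s' - 1)" using p by simp
  also have "\<dots> = s * (1 - s) - s' * (1 - s')" by (simp add: algebra_simps)
  finally show "k s' \<le> k s"
    unfolding k_def using C E by (intro divide_right_mono) auto
  have e1: "1 / k s' - 1 / k s = 2 * C * E * ((s' - s) * (s + s' - 1) / (s * s' * (1 - s) * (1 - s')))"
    using p C E by (simp add: k_def field_simps)
  have e3: "1 / s\<^sup>2 - 1 / s'\<^sup>2 = (s' - s) * (s + s') / (s\<^sup>2 * s'\<^sup>2)"
    using p by (simp add: field_simps power2_eq_square)
  have "?X = (2 * E / (s * E - (1 - s))) * ((s + s' - 1) * s' * (1 - s) / ((s + s') * (1 - s')))"
    unfolding ks e1 e2 e3 using p C E sE
    by (simp add: divide_simps power2_eq_square)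
  also have "\<dots> \<le> (2 / (2 * s - 1)) * ((s + s' - 1) * s' * (1 - s) / ((s + s') * (1 - s')))"
  proof (rule mult_right_mono)
    have "(1 - s) * 1 \<le> (1 - s) * E" using p E by (intro mult_left_mono) auto
    then have "E * (2 * s - 1) \<le> s * E - (1 - s)" by (simp add: algebra_simps)
    then show "2 * E / (s * E - (1 - s)) \<le> 2 / (2 * s - 1)"
      using p sE by (simp add: divide_simps)
  qed (use p in auto)
  also have "\<dots> = (1 + (s' - s) / (2 * s - 1)) * (1 + (s' - s) / (s + s')) * (1 + (s' - s) / (1 - s'))"
    using p by (simp add: divide_simps)
  also have "\<dots> \<le> (1 + \<Lambda> * (s' - s)) * (1 + \<Lambda> * (s' - s)) * (1 + \<Lambda> * (s' - s))"
  proof -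
    have "1 / (2 * s - 1) \<le> 1 / (2 * a - 1)" "1 / (1 - s') \<le> 1 / (1 - b)"
      using s by (auto intro!: divide_left_mono)
    moreover have "0 \<le> 1 / (2 * a - 1)" "1 \<le> 1 / (1 - b)" "1 / (s + s') \<le> 1"
      using s by (auto simp: divide_simps)
    ultimately have "1 / (2 * s - 1) \<le> \<Lambda>" "1 / (1 - s') \<le> \<Lambda>" "1 / (s + s') \<le> \<Lambda>"
      unfolding \<Lambda>_def by linarith+
    then have "(s' - s) / (2 * s - 1) \<le> \<Lambda> * (s' - s)" "(s' - s) / (1 - s') \<le> \<Lambda> * (s' - s)"
      "(s' - s) / (s + s') \<le> \<Lambda> * (s' - s)"
      using p mult_right_mono[of _ \<Lambda> "s' - s"] by fastforce+
    moreover from this have "0 \<le> \<Lambda> * (s' - s)"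
      using p by (meson divide_nonneg_pos less_imp_le order_trans)
    ultimately show ?thesis using p by (intro mult_mono add_left_mono) auto
  qed
  also have "\<dots> \<le> 1 + 7 * \<Lambda> ^ 3 * (s' - s)"
  proof -
    define d where "d = s' - s"
    have d: "0 < d" "d \<le> 1" using s by (auto simp: d_def)
    have "0 \<le> 1 / (2 * a - 1)" "1 \<le> 1 / (1 - b)"
      using s by (auto simp: divide_simps)
    then have \<Lambda>: "1 \<le> \<Lambda>" unfolding \<Lambda>_def by linarith
    have "\<Lambda> * d \<le> \<Lambda> ^ 3 * d" using \<Lambda> d self_le_power[of \<Lambda> 3] by simp
    moreover have "\<Lambda> ^ 2 * d ^ 2 \<le> \<Lambda> ^ 3 * d"
      using \<Lambda> d power_increasing[of 2 3 \<Lambda>] power_decreasing[of 1 2 d] by (intro mult_mono) auto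
    moreover have "\<Lambda> ^ 3 * d ^ 3 \<le> \<Lambda> ^ 3 * d"
      using \<Lambda> d power_decreasing[of 1 3 d] by (intro mult_left_mono) auto
    moreover have "(1 + \<Lambda> * d) * (1 + \<Lambda> * d) * (1 + \<Lambda> * d)
        = 1 + 3 * (\<Lambda> * d) + 3 * (\<Lambda> ^ 2 * d ^ 2) + \<Lambda> ^ 3 * d ^ 3"
      by (simp add: algebra_simps power2_eq_square power3_eq_cube)
    ultimately show ?thesis unfolding d_def[symmetric] by linarith
  qed
  finally show "?X \<le> 1 + 7 * \<Lambda> ^ 3 * (s' - s)" .
qed

context cost_family
begin

text \<open>
  The functional is nondecreasing along the curve of \<open>step_coefficient\<close>, and as \<open>s\<close> tends to \<open>1\<close>,
  where \<open>k = 0\<close> and \<open>\<theta> = 1\<close>, it becomes the mean of the envelope.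
\<close>

theorem log_laplace_le_integral:
  assumes M: "borel_prob M" and C: "0 < C" and E: "1 \<le> E"
    and L: "restricted_lsi c (1 / (2 * C)) (2 * E) M"
    and a: "1 / 2 < a" "a < 1"
  shows "log_laplace M (a * (1 - a) / (2 * C * E)) (1 / a\<^sup>2) \<le> (\<integral>x. env 1 x \<partial>M)"
proof -
  define k where "k s = s * (1 - s) / (2 * C * E)" for s
  define \<Phi> where "\<Phi> s = log_laplace M (k s) (1 / s\<^sup>2)" for s
  have mono: "\<Phi> a \<le> \<Phi> b" if b: "a \<le> b" "b < 1" for b
  proof (rule mono_of_quadratic_defect[OF b(1)])
    fix s s' assume s: "a \<le> s" "s < s'" "s' \<le> b"
    define \<Lambda> where "\<Lambda> = 1 / (2 * a - 1) + 1 / (1 - b)"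
    have \<Lambda>: "0 \<le> \<Lambda>" unfolding \<Lambda>_def using a b by simp
    have ord: "1 \<le> 1 / s'\<^sup>2" "1 / s'\<^sup>2 < 1 / s\<^sup>2"
      using a b s by (auto simp: power_le_one intro!: divide_strict_left_mono power_strict_mono)
    have kpos: "0 < k s'" unfolding k_def using a b s C E by simp
    note coeff = step_coefficient[OF a(1) s b(2) E C, folded k_def \<Lambda>_def]
    obtain J where J: "0 \<le> J" "J \<le> (1 / s\<^sup>2 - 1 / s'\<^sup>2) * spread"
      and le: "J * (1 - (1 / k s' - 1 / k s) * (2 * E) * (k s * (1 / s\<^sup>2))\<^sup>2
          / ((1 / (2 * C) - k s * (1 / s\<^sup>2)) * (1 / s\<^sup>2 - 1 / s'\<^sup>2))) \<le> \<Phi> s' - \<Phi> s"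
      unfolding \<Phi>_def by (rule log_laplace_step[OF M L _ kpos coeff(3) ord coeff(2)]) (use E in auto)
    have "1 / s\<^sup>2 - 1 / s'\<^sup>2 = (s' - s) * ((s + s') / (s\<^sup>2 * s'\<^sup>2))"
      using a s by (simp add: field_simps power2_eq_square)
    also have "\<dots> \<le> (s' - s) * 32"
    proof (intro mult_left_mono)
      have "(1/2) ^ 2 * (1/2) ^ 2 \<le> s\<^sup>2 * s'\<^sup>2"
        using a s by (intro mult_mono power_mono) auto
      then have "s + s' \<le> 32 * (s\<^sup>2 * s'\<^sup>2)" using s b by (simp add: power2_eq_square)
      then show "(s + s') / (s\<^sup>2 * s'\<^sup>2) \<le> 32"
        using a s by (simp add: pos_divide_le_eq)
    qed (use s in auto)
    finally have "J \<le> (s' - s) * 32 * spread"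
      using J(2) spread_nonneg by (meson mult_right_mono order_trans)
    then have "J * (7 * \<Lambda> ^ 3 * (s' - s)) \<le> (s' - s) * 32 * spread * (7 * \<Lambda> ^ 3 * (s' - s))"
      using \<Lambda> s by (intro mult_right_mono) auto
    also have "\<dots> = 224 * spread * \<Lambda> ^ 3 * (s' - s)\<^sup>2" by (simp add: power2_eq_square algebra_simps)
    finally have "- (224 * spread * \<Lambda> ^ 3) * (s' - s)\<^sup>2 \<le> J * (1 - (1 + 7 * \<Lambda> ^ 3 * (s' - s)))"
      by simp
    also have "\<dots> \<le> \<Phi> s' - \<Phi> s"
      by (rule order_trans[OF mult_left_mono le]) (use J coeff(1) in auto)
    finally show "- (224 * spread * (1 / (2 * a - 1) + 1 / (1 - b)) ^ 3) * (s' - s)\<^sup>2 \<le> \<Phi> s' - \<Phi> s"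
      by (simp add: \<Lambda>_def)
  qed
  obtain B where B: "\<And>x. \<bar>env 1 x\<bar> \<le> B" "0 < B"
    using env_bounded[of 1] by (auto simp: bounded_pos)
  have "\<Phi> a \<le> (\<integral>x. env 1 x \<partial>M)"
  proof (rule tendsto_lowerbound)
    have "((\<lambda>s. (\<integral>x. env 1 x \<partial>M) + 2 * k s * B\<^sup>2) \<longlongrightarrow> (\<integral>x. env 1 x \<partial>M) + 2 * k 1 * B\<^sup>2) (at_left 1)"
      unfolding k_def by (intro tendsto_intros) (use C E in auto)
    then show "((\<lambda>s. (\<integral>x. env 1 x \<partial>M) + 2 * k s * B\<^sup>2) \<longlongrightarrow> (\<integral>x. env 1 x \<partial>M)) (at_left 1)"
      by (simp add: k_def)
    have "((\<lambda>s. k s * B) \<longlongrightarrow> k 1 * B) (at_left 1)"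
      unfolding k_def by (intro tendsto_intros) (use C E in auto)
    then have "eventually (\<lambda>s. k s * B < 1 / 2) (at_left 1)"
      by (rule order_tendstoD) (simp add: k_def)
    moreover have "eventually (\<lambda>s. s \<in> {a<..<1}) (at_left (1::real))"
      using a by (intro eventually_at_left_real)
    ultimately show "eventually (\<lambda>s. \<Phi> a \<le> (\<integral>x. env 1 x \<partial>M) + 2 * k s * B\<^sup>2) (at_left 1)"
    proof eventually_elim
      case (elim s)
      have "\<Phi> a \<le> \<Phi> s" using elim by (intro mono) auto
      also have "\<dots> \<le> (\<integral>x. env 1 x \<partial>M) + 2 * k s * B\<^sup>2"
        unfolding \<Phi>_def using elim a C E B
        by (intro log_laplace_le_mean M) (auto simp: k_def power_le_one)
      finally show ?case .
    qed
  qed simp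
  then show ?thesis by (simp add: \<Phi>_def k_def)
qed

end

section \<open>Semi-discrete Kantorovich duality\<close>

text \<open>
  The box is compact in the product topology on functions; only the coordinates in \<open>I\<close> matter, the
  others are pinned to \<open>0\<close>.
\<close>

lemma max_attained_on_box:
  fixes \<Psi> :: "('i \<Rightarrow> real) \<Rightarrow> real"
  assumes fin: "finite I" and R: "0 \<le> R"
    and lip: "\<And>h h'. \<bar>\<Psi> h - \<Psi> h'\<bar> \<le> L * (\<Sum>i\<in>I. \<bar>h i - h' i\<bar>)"
  obtains h where "\<And>h'. (\<And>i. i \<in> I \<Longrightarrow> h' i \<in> {-R..0}) \<Longrightarrow> \<Psi> h' \<le> \<Psi> h"
proof -
  define S where "S = (PiE UNIV (\<lambda>i. if i \<in> I then {-R..0} else {0}) :: ('i \<Rightarrow> real) set)"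
  have "compactin (product_topology (\<lambda>i. euclidean) UNIV) S"
    unfolding S_def by (auto simp: compactin_PiE)
  then have comp: "compact S" by (simp add: euclidean_product_topology)
  have cont: "continuous_on S \<Psi>"
    unfolding continuous_on_def
  proof
    fix h assume "h \<in> S"
    have coord: "((\<lambda>h'. h' i) \<longlongrightarrow> h i) (at h within S)" for i
      using continuous_on_product_coordinates[of i] continuous_on_subset[of UNIV _ S] \<open>h \<in> S\<close>
      by (auto simp: continuous_on_def)
    have "((\<lambda>h'. L * (\<Sum>i\<in>I. \<bar>h' i - h i\<bar>)) \<longlongrightarrow> L * (\<Sum>i\<in>I. \<bar>h i - h i\<bar>)) (at h within S)"
      by (intro tendsto_intros coord)
    then have "((\<lambda>h'. L * (\<Sum>i\<in>I. \<bar>h' i - h i\<bar>)) \<longlongrightarrow> 0) (at h within S)" by simp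
    then have "((\<lambda>h'. \<Psi> h' - \<Psi> h) \<longlongrightarrow> 0) (at h within S)"
      by (rule Lim_null_comparison[rotated]) (use lip in auto)
    then show "(\<Psi> \<longlongrightarrow> \<Psi> h) (at h within S)" by (rule LIM_zero_cancel)
  qed
  have "(\<lambda>_. 0) \<in> S" using R by (auto simp: S_def)
  then obtain h where h: "\<And>h'. h' \<in> S \<Longrightarrow> \<Psi> h' \<le> \<Psi> h"
    using continuous_attains_sup[OF comp _ cont] by auto
  show thesis
  proof (rule that)
    fix h' assume h': "\<And>i. i \<in> I \<Longrightarrow> h' i \<in> {-R..0}"
    define h'' where "h'' i = (if i \<in> I then h' i else 0)" for i
    have "(\<Sum>i\<in>I. \<bar>h' i - h'' i\<bar>) = 0" by (simp add: h''_def)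
    then have "\<Psi> h' = \<Psi> h''" using lip[of h' h''] by simp
    also have "h'' \<in> S" using h' by (auto simp: S_def h''_def)
    then have "\<Psi> h'' \<le> \<Psi> h" by (rule h)
    finally show "\<Psi> h' \<le> \<Psi> h" .
  qed
qed

text \<open>
  A probability measure with finitely many atoms of mass \<open>a i\<close> is to be coupled with \<open>M\<close>, where \<open>b i y\<close> is
  the cost of moving atom \<open>i\<close> to \<open>y\<close>. A coupling amounts to a partition of unity with integrals \<open>a i\<close>.
  The maximum in the dual problem is replaced by its smooth version at scale \<open>\<epsilon>\<close>: this makes the
  maximiser of the dual problem yield a coupling directly, through the derivatives of the
  \<open>softmax\<close>, and loses only a multiple of \<open>\<epsilon>\<close> in the cost.
\<close>

locale semidiscrete = prob_space M
  for M :: "'b measure" +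
  fixes I :: "'i set" and a :: "'i \<Rightarrow> real" and b :: "'i \<Rightarrow> 'b \<Rightarrow> real" and \<epsilon> :: real
  assumes fin: "finite I" and nonempty: "I \<noteq> {}"
    and a_pos: "i \<in> I \<Longrightarrow> 0 < a i" and a_sum: "sum a I = 1"
    and b_int: "i \<in> I \<Longrightarrow> integrable M (b i)" and b_nonneg: "i \<in> I \<Longrightarrow> 0 \<le> b i y"
    and eps: "0 < \<epsilon>"
begin

definition partition_sum :: "('i \<Rightarrow> real) \<Rightarrow> 'b \<Rightarrow> real" where
  "partition_sum h y = (\<Sum>i\<in>I. exp ((h i - b i y) / \<epsilon>))"

definition softmax :: "('i \<Rightarrow> real) \<Rightarrow> 'b \<Rightarrow> real" where
  "softmax h y = \<epsilon> * ln (partition_sum h y)"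

definition weight :: "('i \<Rightarrow> real) \<Rightarrow> 'i \<Rightarrow> 'b \<Rightarrow> real" where
  "weight h i y = exp ((h i - b i y) / \<epsilon>) / partition_sum h y"

definition dual_value :: "('i \<Rightarrow> real) \<Rightarrow> real" where
  "dual_value h = (\<Sum>i\<in>I. a i * h i) - (\<integral>y. softmax h y \<partial>M)"

lemma b_measurable [measurable]: "i \<in> I \<Longrightarrow> b i \<in> borel_measurable M"
  using b_int by auto

lemma partition_sum_pos: "0 < partition_sum h y"
  unfolding partition_sum_def using fin nonempty by (intro sum_pos) auto

lemma partition_sum_measurable [measurable]: "partition_sum h \<in> borel_measurable M"
  unfolding partition_sum_def[abs_def] by measurable

lemma softmax_measurable [measurable]: "softmax h \<in> borel_measurable M"
  unfolding softmax_def[abs_def] by measurable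

lemma weight_measurable [measurable]: "i \<in> I \<Longrightarrow> weight h i \<in> borel_measurable M"
  unfolding weight_def[abs_def] by measurable

lemma weight_pos: "0 < weight h i y"
  unfolding weight_def using partition_sum_pos by simp

lemma sum_weight: "(\<Sum>i\<in>I. weight h i y) = 1"
  unfolding weight_def sum_divide_distrib[symmetric] partition_sum_def[symmetric]
  using partition_sum_pos[of h y] by simp

lemma weight_le_1: "i \<in> I \<Longrightarrow> weight h i y \<le> 1"
  using member_le_sum[of i I "\<lambda>i. weight h i y"] fin weight_pos sum_weight[of h y]
  by (simp add: less_imp_le)

lemma weight_integrable: "i \<in> I \<Longrightarrow> integrable M (weight h i)"
  by (intro integrable_const_bound[of _ 1]) (auto simp: weight_le_1 weight_pos less_imp_le abs_of_pos)

lemma softmax_weight: "softmax h y = h i - b i y - \<epsilon> * ln (weight h i y)"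
  using partition_sum_pos[of h y] eps
  by (simp add: softmax_def weight_def ln_div field_simps)

lemma softmax_ge: "i \<in> I \<Longrightarrow> h i - b i y \<le> softmax h y"
  using softmax_weight[of h y i] weight_le_1[of i h y] weight_pos[of h i y] eps
  by (simp add: mult_nonneg_nonpos)

lemma softmax_mono_shift:
  assumes "\<And>i. i \<in> I \<Longrightarrow> h i \<le> h' i + t"
  shows "softmax h y \<le> softmax h' y + t"
proof -
  have "partition_sum h y \<le> (\<Sum>i\<in>I. exp (t / \<epsilon>) * exp ((h' i - b i y) / \<epsilon>))"
    unfolding partition_sum_def mult_exp_exp
    using assms eps by (intro sum_mono) (auto simp: add_divide_distrib[symmetric] divide_right_mono field_simps)
  also have "\<dots> = exp (t / \<epsilon>) * partition_sum h' y"
    by (simp add: partition_sum_def sum_distrib_left)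
  finally have "ln (partition_sum h y) \<le> ln (exp (t / \<epsilon>) * partition_sum h' y)"
    using partition_sum_pos[of h y] by simp
  also have "\<dots> = t / \<epsilon> + ln (partition_sum h' y)"
    using partition_sum_pos[of h' y] by (simp add: ln_mult)
  finally have "\<epsilon> * ln (partition_sum h y) \<le> \<epsilon> * (t / \<epsilon> + ln (partition_sum h' y))"
    using eps by simp
  then show ?thesis using eps by (simp add: softmax_def distrib_left)
qed

lemma softmax_integrable: "integrable M (softmax h)"
proof -
  obtain j where j: "j \<in> I" using nonempty by auto
  define K where "K = \<epsilon> * ln (\<Sum>i\<in>I. exp (h i / \<epsilon>))"
  have upper: "softmax h y \<le> K" for y
  proof -
    have "partition_sum h y \<le> (\<Sum>i\<in>I. exp (h i / \<epsilon>))"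
      unfolding partition_sum_def using b_nonneg eps by (intro sum_mono) (simp add: divide_right_mono)
    then have "ln (partition_sum h y) \<le> ln (\<Sum>i\<in>I. exp (h i / \<epsilon>))"
      using partition_sum_pos[of h y] by (intro ln_mono) auto
    then show ?thesis using eps by (simp add: softmax_def K_def)
  qed
  show ?thesis
  proof (rule Bochner_Integration.integrable_bound)
    show "integrable M (\<lambda>y. \<bar>h j\<bar> + b j y + \<bar>K\<bar>)" using b_int[OF j] by simp
    show "AE y in M. norm (softmax h y) \<le> norm (\<bar>h j\<bar> + b j y + \<bar>K\<bar>)"
    proof (rule AE_I2)
      fix y
      show "norm (softmax h y) \<le> norm (\<bar>h j\<bar> + b j y + \<bar>K\<bar>)"
        using upper[of y] softmax_ge[OF j, of h y] b_nonneg[OF j, of y] by (simp add: abs_if)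
    qed
  qed simp
qed

lemma dual_value_lipschitz:
  "\<bar>dual_value h - dual_value h'\<bar> \<le> 2 * (\<Sum>i\<in>I. \<bar>h i - h' i\<bar>)"
proof -
  have one: "dual_value h - dual_value h' \<le> 2 * (\<Sum>i\<in>I. \<bar>h i - h' i\<bar>)" for h h' :: "'i \<Rightarrow> real"
  proof -
    define D where "D = (\<Sum>i\<in>I. \<bar>h i - h' i\<bar>)"
    have D: "\<bar>h i - h' i\<bar> \<le> D" if "i \<in> I" for i
      unfolding D_def using member_le_sum[of i I "\<lambda>i. \<bar>h i - h' i\<bar>"] that fin by simp
    have "(\<Sum>i\<in>I. a i * h i) \<le> (\<Sum>i\<in>I. a i * (h' i + D))"
      using D a_pos by (intro sum_mono mult_left_mono) (force simp: abs_le_iff less_imp_le)+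
    also have "\<dots> = (\<Sum>i\<in>I. a i * h' i) + D"
      by (simp add: distrib_left sum.distrib sum_distrib_right[symmetric] a_sum)
    finally have 1: "(\<Sum>i\<in>I. a i * h i) - (\<Sum>i\<in>I. a i * h' i) \<le> D" by simp
    have "(\<integral>y. softmax h' y \<partial>M) \<le> (\<integral>y. softmax h y + D \<partial>M)"
      using softmax_integrable D
      by (intro integral_mono softmax_mono_shift) (force simp: abs_le_iff)+
    then have 2: "(\<integral>y. softmax h' y \<partial>M) \<le> (\<integral>y. softmax h y \<partial>M) + D"
      using softmax_integrable by (simp add: prob_space)
    show ?thesis using 1 2 unfolding dual_value_def D_def[symmetric] by linarith
  qed
  show ?thesis using one[of h h'] one[of h' h] by (simp add: abs_le_iff abs_minus_commute)
qed

lemma dual_value_shift: "dual_value (\<lambda>i. h i + t) = dual_value h"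
proof -
  have "softmax (\<lambda>i. h i + t) y = softmax h y + t" for y
    using softmax_mono_shift[of "\<lambda>i. h i + t" h t y] softmax_mono_shift[of h "\<lambda>i. h i + t" "- t" y]
    by simp
  then show ?thesis using softmax_integrable
    by (simp add: dual_value_def distrib_left sum.distrib sum_distrib_right[symmetric] a_sum prob_space)
qed

text \<open>
  Adding a constant to \<open>h\<close> does not change the dual value, so the largest height may be taken to be
  \<open>0\<close>. A very negative height then makes the dual value small because every atom has positive mass.
  This confines the search for a maximiser to a box.
\<close>

lemma dual_value_coercive:
  assumes j: "j \<in> I" and le: "\<And>i. i \<in> I \<Longrightarrow> h i \<le> 0" and l: "l \<in> I" "h l = 0"
  shows "dual_value h \<le> a j * h j + (\<Sum>i\<in>I. \<integral>y. b i y \<partial>M)"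
proof -
  have "(\<Sum>i\<in>I. a i * h i) = a j * h j + (\<Sum>i\<in>I - {j}. a i * h i)"
    using fin j by (simp add: sum.remove)
  also have "(\<Sum>i\<in>I - {j}. a i * h i) \<le> 0"
    using le a_pos by (intro sum_nonpos) (auto simp: mult_nonneg_nonpos less_imp_le)
  finally have 1: "(\<Sum>i\<in>I. a i * h i) \<le> a j * h j" by simp
  have "(\<integral>y. - b l y \<partial>M) \<le> (\<integral>y. softmax h y \<partial>M)"
    using softmax_ge[OF l(1), of h] l b_int softmax_integrable by (intro integral_mono) auto
  moreover have "(\<integral>y. b l y \<partial>M) \<le> (\<Sum>i\<in>I. \<integral>y. b i y \<partial>M)"
    using fin l b_nonneg by (intro member_le_sum) auto
  ultimately show ?thesis using 1 unfolding dual_value_def by simp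
qed

lemma dual_value_max: obtains h where "\<And>h'. dual_value h' \<le> dual_value h"
proof -
  define \<beta> where "\<beta> = (\<Sum>i\<in>I. \<integral>y. b i y \<partial>M)"
  \<comment> \<open>A height below \<open>- R\<close> makes the dual value smaller than its value at \<open>0\<close>.\<close>
  define R where "R = (\<Sum>i\<in>I. \<bar>\<beta> - dual_value (\<lambda>_. 0)\<bar> / a i)"
  have R_ge: "\<bar>\<beta> - dual_value (\<lambda>_. 0)\<bar> / a j \<le> R" if "j \<in> I" for j
    unfolding R_def using fin that a_pos
    by (intro member_le_sum) (auto simp: less_imp_le)
  have R: "0 \<le> R" unfolding R_def using a_pos by (intro sum_nonneg) (auto simp: less_imp_le)
  obtain h where h: "\<And>h'. (\<And>i. i \<in> I \<Longrightarrow> h' i \<in> {-R..0}) \<Longrightarrow> dual_value h' \<le> dual_value h"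
    using max_attained_on_box[OF fin R dual_value_lipschitz] by blast
  show thesis
  proof (rule that)
    fix h' :: "'i \<Rightarrow> real"
    define t where "t = Max (h' ` I)"
    define g where "g i = h' i + (- t)" for i
    have g: "g i \<le> 0" if "i \<in> I" for i using that fin by (simp add: g_def t_def)
    have "t \<in> h' ` I" unfolding t_def using fin nonempty by (intro Max_in) auto
    then obtain l where l: "l \<in> I" "g l = 0" by (auto simp: g_def)
    have eq: "dual_value h' = dual_value g"
      unfolding g_def by (rule dual_value_shift[symmetric])
    show "dual_value h' \<le> dual_value h"
    proof (cases "\<forall>i\<in>I. - R \<le> g i")
      case True
      then show ?thesis unfolding eq using g by (intro h) auto
    next
      case False
      then obtain j where j: "j \<in> I" "g j < - R" by force
      have "a j * g j \<le> a j * (- (\<bar>\<beta> - dual_value (\<lambda>_. 0)\<bar> / a j))"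
        using j R_ge[OF j(1)] a_pos[OF j(1)] by (intro mult_left_mono) auto
      also have "\<dots> = - \<bar>\<beta> - dual_value (\<lambda>_. 0)\<bar>" using a_pos[OF j(1)] by simp
      finally have "dual_value g \<le> dual_value (\<lambda>_. 0)"
        using dual_value_coercive[of j g l, OF j(1) g l] unfolding \<beta>_def[symmetric] by linarith
      also have "\<dots> \<le> dual_value h" using R by (intro h) auto
      finally show ?thesis unfolding eq .
    qed
  qed
qed

text \<open>
  The first-order condition at the maximiser in the direction of the single height \<open>h i\<close>. Changing it
  by \<open>t\<close> multiplies the partition sum by \<open>1 + w (e\<^bsup>t/\<epsilon>\<^esup> - 1)\<close>, so by \<open>ln (1 + u) \<le> u\<close> the nonnegative loss of
  dual value is at most the explicit function \<open>G t\<close>, which has derivative \<open>W - a i\<close> at its minimum \<open>t = 0\<close>.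
\<close>

lemma weight_marginal:
  assumes max: "\<And>h'. dual_value h' \<le> dual_value h" and i: "i \<in> I"
  shows "(\<integral>y. weight h i y \<partial>M) = a i"
proof -
  define W where "W = (\<integral>y. weight h i y \<partial>M)"
  define G where "G t = \<epsilon> * (exp (t / \<epsilon>) - 1) * W - t * a i" for t
  have "0 \<le> G t" for t
  proof -
    define h' where "h' = h(i := h i + t)"
    have ps: "partition_sum h' y = partition_sum h y * (1 + weight h i y * (exp (t / \<epsilon>) - 1))" for y
    proof -
      have "partition_sum h' y = exp ((h i + t - b i y) / \<epsilon>) + (\<Sum>j\<in>I - {i}. exp ((h j - b j y) / \<epsilon>))"
        unfolding partition_sum_def using fin i by (simp add: sum.remove h'_def)
      also have "(\<Sum>j\<in>I - {i}. exp ((h j - b j y) / \<epsilon>)) = partition_sum h y - exp ((h i - b i y) / \<epsilon>)"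
        unfolding partition_sum_def using fin i by (simp add: sum.remove)
      also have "exp ((h i + t - b i y) / \<epsilon>) = exp ((h i - b i y) / \<epsilon>) * exp (t / \<epsilon>)"
        unfolding mult_exp_exp by (simp add: add_divide_distrib diff_divide_distrib)
      also have "exp ((h i - b i y) / \<epsilon>) = partition_sum h y * weight h i y"
        using partition_sum_pos[of h y] by (simp add: weight_def)
      finally show ?thesis by (simp add: algebra_simps)
    qed
    have up: "softmax h' y \<le> softmax h y + \<epsilon> * (weight h i y * (exp (t / \<epsilon>) - 1))" for y
    proof -
      have pos: "0 < 1 + weight h i y * (exp (t / \<epsilon>) - 1)"
        using partition_sum_pos[of h' y] partition_sum_pos[of h y] unfolding ps
        by (simp add: zero_less_mult_iff)
      have "ln (partition_sum h' y) \<le> ln (partition_sum h y) + weight h i y * (exp (t / \<epsilon>) - 1)"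
        unfolding ps using partition_sum_pos[of h y] pos ln_le_minus_one[OF pos]
        by (simp add: ln_mult)
      then have "\<epsilon> * ln (partition_sum h' y)
          \<le> \<epsilon> * (ln (partition_sum h y) + weight h i y * (exp (t / \<epsilon>) - 1))"
        using eps by simp
      then show ?thesis by (simp add: softmax_def distrib_left)
    qed
    have "(\<integral>y. softmax h' y \<partial>M) \<le> (\<integral>y. softmax h y + \<epsilon> * (weight h i y * (exp (t / \<epsilon>) - 1)) \<partial>M)"
      using softmax_integrable weight_integrable[OF i] up by (intro integral_mono) auto
    also have "\<dots> = (\<integral>y. softmax h y \<partial>M) + \<epsilon> * (exp (t / \<epsilon>) - 1) * W"
      using softmax_integrable weight_integrable[OF i] by (simp add: W_def)
    finally have 1: "(\<integral>y. softmax h' y \<partial>M) \<le> (\<integral>y. softmax h y \<partial>M) + \<epsilon> * (exp (t / \<epsilon>) - 1) * W" .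
    have "(\<Sum>j\<in>I. a j * h' j) = (\<Sum>j\<in>I. a j * h j) + t * a i"
      using fin i by (simp add: sum.remove h'_def algebra_simps)
    then show ?thesis using 1 max[of h'] unfolding dual_value_def G_def by linarith
  qed
  moreover have "G 0 = 0" by (simp add: G_def)
  moreover have "(G has_real_derivative W - a i) (at 0)"
    unfolding G_def by (rule derivative_eq_intros refl | use eps in simp)+
  ultimately have "W - a i = 0"
    by (intro DERIV_local_min[of G _ 0 1]) auto
  then show ?thesis by (simp add: W_def)
qed

text \<open>
  For the weights at the maximiser, \<open>b i = h i - softmax h - \<epsilon> ln (w i)\<close>. Averaging with the weights turns
  the cost into the dual value plus \<open>\<epsilon>\<close> times the entropy of the weights, and each \<open>- w ln w\<close> is at most \<open>1\<close>.
\<close>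

theorem semidiscrete_duality:
  assumes dual: "\<And>h. (\<Sum>i\<in>I. a i * h i) \<le> (\<integral>y. Max ((\<lambda>i. h i - b i y) ` I) \<partial>M) + B"
  obtains w where "\<And>i. i \<in> I \<Longrightarrow> w i \<in> borel_measurable M"
    "\<And>i y. 0 \<le> w i y" "\<And>y. (\<Sum>i\<in>I. w i y) = 1" "\<And>i y. i \<in> I \<Longrightarrow> w i y \<le> 1"
    "\<And>i. i \<in> I \<Longrightarrow> (\<integral>y. w i y \<partial>M) = a i"
    "(\<integral>y. (\<Sum>i\<in>I. w i y * b i y) \<partial>M) \<le> B + \<epsilon> * card I"
proof -
  obtain h where max: "\<And>h'. dual_value h' \<le> dual_value h" by (rule dual_value_max) blast
  let ?w = "weight h"
  have wb: "integrable M (\<lambda>y. ?w i y * b i y)" if i: "i \<in> I" for i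
  proof (rule Bochner_Integration.integrable_bound[OF b_int[OF i]])
    show "AE y in M. norm (?w i y * b i y) \<le> norm (b i y)"
      using weight_le_1[OF i] weight_pos[of h i] b_nonneg[OF i]
      by (intro AE_I2) (simp add: abs_mult mult_left_le_one_le less_imp_le)
  qed (use i in simp)
  have wh: "(\<Sum>i\<in>I. ?w i y * b i y) \<le> (\<Sum>i\<in>I. ?w i y * h i) - softmax h y + \<epsilon> * card I" for y
  proof -
    have "?w i y * b i y \<le> ?w i y * h i - ?w i y * softmax h y + \<epsilon>" if "i \<in> I" for i
    proof -
      have w: "0 < ?w i y" by (rule weight_pos)
      have "- ln (?w i y) \<le> 1 / ?w i y"
        using ln_le_minus_one[of "1 / ?w i y"] w by (simp add: ln_div)
      then have "?w i y * (- ln (?w i y)) \<le> 1" using w by (simp add: field_simps)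
      then have "\<epsilon> * (?w i y * (- ln (?w i y))) \<le> \<epsilon> * 1" using eps by (intro mult_left_mono) auto
      then show ?thesis unfolding softmax_weight[of h y i] by (simp add: algebra_simps)
    qed
    then have "(\<Sum>i\<in>I. ?w i y * b i y) \<le> (\<Sum>i\<in>I. ?w i y * h i - ?w i y * softmax h y + \<epsilon>)"
      by (intro sum_mono) auto
    also have "\<dots> = (\<Sum>i\<in>I. ?w i y * h i) - softmax h y + \<epsilon> * card I"
      by (simp add: sum.distrib sum_subtractf sum_distrib_right[symmetric] sum_weight)
    finally show ?thesis .
  qed
  have "(\<integral>y. (\<Sum>i\<in>I. ?w i y * b i y) \<partial>M)
      \<le> (\<integral>y. (\<Sum>i\<in>I. ?w i y * h i) - softmax h y + \<epsilon> * card I \<partial>M)"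
    using wb wh weight_integrable softmax_integrable by (intro integral_mono) auto
  also have "\<dots> = (\<Sum>i\<in>I. a i * h i) - (\<integral>y. softmax h y \<partial>M) + \<epsilon> * card I"
    using weight_integrable softmax_integrable weight_marginal[OF max] by (simp add: prob_space)
  also have "\<dots> \<le> B + \<epsilon> * card I"
  proof -
    have Max_le: "Max ((\<lambda>i. h i - b i y) ` I) \<le> softmax h y" for y
      using fin nonempty softmax_ge by (subst Max_le_iff) auto
    have "integrable M (\<lambda>y. Max ((\<lambda>i. h i - b i y) ` I))"
    proof -
      obtain j where j: "j \<in> I" using nonempty by auto
      show ?thesis
      proof (rule Bochner_Integration.integrable_bound)
        show "integrable M (\<lambda>y. \<bar>softmax h y\<bar> + (\<bar>h j\<bar> + b j y))"
          using softmax_integrable b_int[OF j] by simp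
        show "AE y in M. norm (Max ((\<lambda>i. h i - b i y) ` I)) \<le> norm (\<bar>softmax h y\<bar> + (\<bar>h j\<bar> + b j y))"
        proof (rule AE_I2)
          fix y
          have "h j - b j y \<le> Max ((\<lambda>i. h i - b i y) ` I)" using fin j by (intro Max_ge) auto
          then show "norm (Max ((\<lambda>i. h i - b i y) ` I)) \<le> norm (\<bar>softmax h y\<bar> + (\<bar>h j\<bar> + b j y))"
            using Max_le[of y] b_nonneg[OF j, of y] by (simp add: abs_if split: if_splits)
        qed
        show "(\<lambda>y. Max ((\<lambda>i. h i - b i y) ` I)) \<in> borel_measurable M"
          using fin by (intro borel_measurable_Max) auto
      qed
    qed
    then have "(\<integral>y. Max ((\<lambda>i. h i - b i y) ` I) \<partial>M) \<le> (\<integral>y. softmax h y \<partial>M)"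
      using softmax_integrable Max_le by (intro integral_mono) auto
    then show ?thesis using dual[of h] by linarith
  qed
  finally have "(\<integral>y. (\<Sum>i\<in>I. ?w i y * b i y) \<partial>M) \<le> B + \<epsilon> * card I" .
  then show thesis
    by (intro that[of ?w])
      (auto simp: weight_pos less_imp_le sum_weight weight_le_1 weight_marginal[OF max])
qed

end

section \<open>Transport to a discretised measure\<close>

text \<open>
  The map \<open>S\<close> moves \<open>\<nu>\<close> to a measure with finitely many atoms, and \<open>w\<close> is a coupling of that measure with
  \<open>M\<close>. Composing the two would in general require disintegration; here the weights give the
  composed coupling explicitly, as a density with respect to the product measure.
\<close>

locale discretised = source: prob_space \<nu> + target: prob_space M
  for \<nu> M :: "'a::euclidean_space measure" +
  fixes S :: "'a \<Rightarrow> 'a" and I :: "'a set" and w :: "'a \<Rightarrow> 'a \<Rightarrow> real"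
  assumes sets_\<nu>: "sets \<nu> = sets borel" and sets_M: "sets M = sets borel"
    and S_meas [measurable]: "S \<in> borel_measurable borel"
    and fin: "finite I" and S_in: "AE x in \<nu>. S x \<in> I"
    and w_meas: "z \<in> I \<Longrightarrow> w z \<in> borel_measurable borel"
    and w_nonneg: "0 \<le> w z y" and w_sum: "(\<Sum>z\<in>I. w z y) = 1"
    and w_integral: "z \<in> I \<Longrightarrow> (\<integral>y. w z y \<partial>M) = measure \<nu> (S -` {z})"
    and w_int: "z \<in> I \<Longrightarrow> integrable M (w z)"
    and mass_pos: "z \<in> I \<Longrightarrow> 0 < measure \<nu> (S -` {z})"
begin

definition mass :: "'a \<Rightarrow> real" where
  "mass z = measure \<nu> (S -` {z})"

definition plan :: "('a \<times> 'a) measure" where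
  "plan = density (\<nu> \<Otimes>\<^sub>M M)
    (\<lambda>p. \<Sum>z\<in>I. indicator (S -` {z}) (fst p) * ennreal (w z (snd p) / mass z))"

lemma cell_borel [measurable]: "S -` {z} \<in> sets borel"
  using measurable_sets[OF S_meas, of "{z}"] by simp

lemma space_\<nu> [simp]: "space \<nu> = UNIV" and space_M [simp]: "space M = UNIV"
  using sets_eq_imp_space_eq[OF sets_\<nu>] sets_eq_imp_space_eq[OF sets_M] by auto

lemma sets_pair: "sets (\<nu> \<Otimes>\<^sub>M M) = sets borel"
  using sets_pair_measure_cong[OF sets_\<nu> sets_M] unfolding borel_prod .

lemma sets_plan: "sets plan = sets borel"
  by (simp add: plan_def sets_pair)

text \<open>
  Over the cell \<open>S -` {z}\<close> the second coordinate is distributed, independently of the first, with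
  density \<open>w z / mass z\<close> with respect to \<open>M\<close>.
\<close>

lemma plan_integral:
  assumes F: "F \<in> borel_measurable borel"
  shows "(\<integral>\<^sup>+p. F p \<partial>plan)
    = (\<Sum>z\<in>I. \<integral>\<^sup>+x. indicator (S -` {z}) x * (\<integral>\<^sup>+y. ennreal (w z y / mass z) * F (x, y) \<partial>M) \<partial>\<nu>)"
proof -
  have [measurable]: "F \<in> borel_measurable (\<nu> \<Otimes>\<^sub>M M)"
    using F by (simp add: measurable_cong_sets[OF sets_pair refl])
  have [measurable]: "S -` {z} \<in> sets \<nu>" for z by (simp add: sets_\<nu>)
  have [measurable]: "z \<in> I \<Longrightarrow> w z \<in> borel_measurable M" for z
    using w_meas by (simp add: measurable_cong_sets[OF sets_M refl])
  have "(\<integral>\<^sup>+p. F p \<partial>plan) = (\<integral>\<^sup>+p. (\<Sum>z\<in>I. indicator (S -` {z}) (fst p)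
      * (ennreal (w z (snd p) / mass z) * F p)) \<partial>(\<nu> \<Otimes>\<^sub>M M))"
    unfolding plan_def by (subst nn_integral_density) (auto simp: sum_distrib_right mult.assoc)
  also have "\<dots> = (\<Sum>z\<in>I. \<integral>\<^sup>+p. indicator (S -` {z}) (fst p)
      * (ennreal (w z (snd p) / mass z) * F p) \<partial>(\<nu> \<Otimes>\<^sub>M M))"
    by (rule nn_integral_sum) auto
  also have "\<dots> = (\<Sum>z\<in>I. \<integral>\<^sup>+x. indicator (S -` {z}) x * (\<integral>\<^sup>+y. ennreal (w z y / mass z) * F (x, y) \<partial>M) \<partial>\<nu>)"
  proof (rule sum.cong[OF refl])
    fix z assume [simp]: "z \<in> I"
    have "(\<integral>\<^sup>+p. indicator (S -` {z}) (fst p) * (ennreal (w z (snd p) / mass z) * F p) \<partial>(\<nu> \<Otimes>\<^sub>M M))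
       = (\<integral>\<^sup>+x. \<integral>\<^sup>+y. indicator (S -` {z}) x * (ennreal (w z y / mass z) * F (x, y)) \<partial>M \<partial>\<nu>)"
      by (subst target.nn_integral_fst[symmetric]) auto
    also have "\<dots> = (\<integral>\<^sup>+x. indicator (S -` {z}) x * (\<integral>\<^sup>+y. ennreal (w z y / mass z) * F (x, y) \<partial>M) \<partial>\<nu>)"
      by (intro nn_integral_cong nn_integral_cmult) auto
    finally show "(\<integral>\<^sup>+p. indicator (S -` {z}) (fst p) * (ennreal (w z (snd p) / mass z) * F p) \<partial>(\<nu> \<Otimes>\<^sub>M M))
       = \<dots>" .
  qed
  finally show ?thesis .
qed

lemma nn_integral_weight:
  assumes z: "z \<in> I"
  shows "(\<integral>\<^sup>+y. ennreal (w z y / mass z) \<partial>M) = 1"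
proof -
  have m: "0 < mass z" using mass_pos[OF z] by (simp add: mass_def)
  have "(\<integral>\<^sup>+y. ennreal (w z y / mass z) \<partial>M) = ennreal (\<integral>y. w z y / mass z \<partial>M)"
    using w_int[OF z] m w_nonneg by (intro nn_integral_eq_integral) (auto simp: less_imp_le)
  also have "\<dots> = 1" using w_integral[OF z] m by (simp add: mass_def)
  finally show ?thesis .
qed

lemma emeasure_cell: "emeasure \<nu> (S -` {z}) = ennreal (mass z)"
  by (simp add: mass_def source.emeasure_eq_measure)

lemma plan_fst: "distr plan borel fst = \<nu>"
proof (rule measure_eqI)
  show "sets (distr plan borel fst) = sets \<nu>" by (simp add: sets_\<nu>)
  fix A assume "A \<in> sets (distr plan borel fst)"
  then have A [measurable]: "A \<in> sets borel" by simp
  have A\<nu> [measurable]: "A \<in> sets \<nu>" and [measurable]: "S -` {z} \<in> sets \<nu>" for z by (simp_all add: sets_\<nu>)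
  have "fst \<in> measurable plan borel"
    by (simp add: measurable_cong_sets[OF sets_plan refl])
  then have "emeasure (distr plan borel fst) A = (\<integral>\<^sup>+p. indicator A (fst p) \<partial>plan)"
    by (simp add: nn_integral_distr[symmetric])
  also have "\<dots> = (\<Sum>z\<in>I. \<integral>\<^sup>+x. indicator (S -` {z}) x
      * (\<integral>\<^sup>+y. ennreal (w z y / mass z) * indicator A (fst (x, y)) \<partial>M) \<partial>\<nu>)"
    by (rule plan_integral) measurable
  also have "\<dots> = (\<Sum>z\<in>I. \<integral>\<^sup>+x. indicator (S -` {z}) x * indicator A x \<partial>\<nu>)"
  proof (intro sum.cong refl nn_integral_cong)
    fix z x assume z: "z \<in> I"
    have "(\<integral>\<^sup>+y. ennreal (w z y / mass z) * indicator A (fst (x, y)) \<partial>M) = indicator A x"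
      using nn_integral_weight[OF z] by (simp split: split_indicator)
    then show "indicator (S -` {z}) x * (\<integral>\<^sup>+y. ennreal (w z y / mass z) * indicator A (fst (x, y)) \<partial>M)
      = indicator (S -` {z}) x * (indicator A x :: ennreal)" by simp
  qed
  also have "\<dots> = (\<integral>\<^sup>+x. (\<Sum>z\<in>I. indicator (S -` {z}) x * indicator A x) \<partial>\<nu>)"
    by (rule nn_integral_sum[symmetric]) measurable
  also have "\<dots> = (\<integral>\<^sup>+x. indicator A x \<partial>\<nu>)"
  proof (rule nn_integral_cong_AE)
    show "AE x in \<nu>. (\<Sum>z\<in>I. indicator (S -` {z}) x * indicator A x) = (indicator A x :: ennreal)"
      using S_in
    proof eventually_elim
      case (elim x)
      have "(\<Sum>z\<in>I. indicator (S -` {z}) x * indicator A x) = (\<Sum>z\<in>I. if z = S x then indicator A x else 0 :: ennreal)"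
        by (intro sum.cong) (auto split: split_indicator)
      then show ?case using elim fin by simp
    qed
  qed
  also have "\<dots> = emeasure \<nu> A" by simp
  finally show "emeasure (distr plan borel fst) A = emeasure \<nu> A" .
qed

lemma plan_snd: "distr plan borel snd = M"
proof (rule measure_eqI)
  show "sets (distr plan borel snd) = sets M" by (simp add: sets_M)
  fix A assume "A \<in> sets (distr plan borel snd)"
  then have A [measurable]: "A \<in> sets borel" by simp
  have A\<nu> [measurable]: "A \<in> sets M" and [measurable]: "S -` {z} \<in> sets \<nu>" for z
    by (simp_all add: sets_\<nu> sets_M)
  have [measurable]: "z \<in> I \<Longrightarrow> w z \<in> borel_measurable M" for z
    using w_meas by (simp add: measurable_cong_sets[OF sets_M refl])
  have "snd \<in> measurable plan borel"
    by (simp add: measurable_cong_sets[OF sets_plan refl])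
  then have "emeasure (distr plan borel snd) A = (\<integral>\<^sup>+p. indicator A (snd p) \<partial>plan)"
    by (simp add: nn_integral_distr[symmetric])
  also have "\<dots> = (\<Sum>z\<in>I. \<integral>\<^sup>+x. indicator (S -` {z}) x
      * (\<integral>\<^sup>+y. ennreal (w z y / mass z) * indicator A (snd (x, y)) \<partial>M) \<partial>\<nu>)"
    by (rule plan_integral) measurable
  also have "\<dots> = (\<Sum>z\<in>I. \<integral>\<^sup>+y. ennreal (w z y) * indicator A y \<partial>M)"
  proof (rule sum.cong[OF refl])
    fix z assume z: "z \<in> I"
    have m: "0 < mass z" using mass_pos[OF z] by (simp add: mass_def)
    have "(\<integral>\<^sup>+x. indicator (S -` {z}) x * (\<integral>\<^sup>+y. ennreal (w z y / mass z) * indicator A (snd (x, y)) \<partial>M) \<partial>\<nu>)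
      = ennreal (mass z) * (\<integral>\<^sup>+y. ennreal (w z y / mass z) * indicator A y \<partial>M)"
      by (simp add: nn_integral_multc emeasure_cell)
    also have "\<dots> = (\<integral>\<^sup>+y. ennreal (mass z) * (ennreal (w z y / mass z) * indicator A y) \<partial>M)"
      using z by (intro nn_integral_cmult[symmetric]) auto
    also have "\<dots> = (\<integral>\<^sup>+y. ennreal (w z y) * indicator A y \<partial>M)"
      using m w_nonneg
      by (intro nn_integral_cong) (simp add: mult.assoc[symmetric] ennreal_mult[symmetric] less_imp_le)
    finally show "(\<integral>\<^sup>+x. indicator (S -` {z}) x * (\<integral>\<^sup>+y. ennreal (w z y / mass z) * indicator A (snd (x, y)) \<partial>M) \<partial>\<nu>)
      = \<dots>" .
  qed
  also have "\<dots> = (\<integral>\<^sup>+y. (\<Sum>z\<in>I. ennreal (w z y) * indicator A y) \<partial>M)"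
    by (rule nn_integral_sum[symmetric]) auto
  also have "\<dots> = (\<integral>\<^sup>+y. indicator A y \<partial>M)"
    using w_nonneg by (simp add: sum_distrib_right[symmetric] sum_ennreal w_sum)
  also have "\<dots> = emeasure M A" by simp
  finally show "emeasure (distr plan borel snd) A = emeasure M A" .
qed

lemma plan_coupling: "plan \<in> couplings \<nu> M"
proof -
  have "fst \<in> measurable plan borel"
    by (simp add: measurable_cong_sets[OF sets_plan refl])
  moreover have "prob_space (distr plan borel fst)"
    unfolding plan_fst by (rule source.prob_space_axioms)
  ultimately have "prob_space plan" by (rule prob_space_distrD)
  then show ?thesis by (simp add: couplings_def borel_prob_def sets_plan plan_fst plan_snd)
qed

lemma plan_discrete_cost:
  assumes [measurable]: "c \<in> borel_measurable borel" and c: "\<And>x. (0::real) \<le> c x"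
  shows "(\<integral>\<^sup>+p. ennreal (c (S (fst p) - snd p)) \<partial>plan) = (\<integral>\<^sup>+y. ennreal (\<Sum>z\<in>I. w z y * c (z - y)) \<partial>M)"
proof -
  have [measurable]: "S -` {z} \<in> sets \<nu>" for z by (simp add: sets_\<nu>)
  have [measurable]: "(\<lambda>y. c (z - y)) \<in> borel_measurable M" for z
    by (simp add: measurable_cong_sets[OF sets_M refl])
  have [measurable]: "z \<in> I \<Longrightarrow> w z \<in> borel_measurable M" for z
    using w_meas by (simp add: measurable_cong_sets[OF sets_M refl])
  have "(\<integral>\<^sup>+p. ennreal (c (S (fst p) - snd p)) \<partial>plan)
      = (\<Sum>z\<in>I. \<integral>\<^sup>+x. indicator (S -` {z}) x
        * (\<integral>\<^sup>+y. ennreal (w z y / mass z) * ennreal (c (S (fst (x, y)) - snd (x, y))) \<partial>M) \<partial>\<nu>)"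
    by (rule plan_integral) measurable
  also have "\<dots> = (\<Sum>z\<in>I. \<integral>\<^sup>+y. ennreal (w z y * c (z - y)) \<partial>M)"
  proof (rule sum.cong[OF refl])
    fix z assume z: "z \<in> I"
    have m: "0 < mass z" using mass_pos[OF z] by (simp add: mass_def)
    have "(\<integral>\<^sup>+x. indicator (S -` {z}) x
        * (\<integral>\<^sup>+y. ennreal (w z y / mass z) * ennreal (c (S (fst (x, y)) - snd (x, y))) \<partial>M) \<partial>\<nu>)
      = (\<integral>\<^sup>+x. indicator (S -` {z}) x * (\<integral>\<^sup>+y. ennreal (w z y / mass z) * ennreal (c (z - y)) \<partial>M) \<partial>\<nu>)"
      by (intro nn_integral_cong) (simp split: split_indicator)
    also have "\<dots> = ennreal (mass z) * (\<integral>\<^sup>+y. ennreal (w z y / mass z) * ennreal (c (z - y)) \<partial>M)"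
      by (simp add: nn_integral_multc emeasure_cell)
    also have "\<dots> = (\<integral>\<^sup>+y. ennreal (mass z) * (ennreal (w z y / mass z) * ennreal (c (z - y))) \<partial>M)"
      using z by (intro nn_integral_cmult[symmetric]) auto
    also have "\<dots> = (\<integral>\<^sup>+y. ennreal (w z y * c (z - y)) \<partial>M)"
      using m w_nonneg c
      by (intro nn_integral_cong) (simp add: ennreal_mult[symmetric] less_imp_le)
    finally show "(\<integral>\<^sup>+x. indicator (S -` {z}) x
        * (\<integral>\<^sup>+y. ennreal (w z y / mass z) * ennreal (c (S (fst (x, y)) - snd (x, y))) \<partial>M) \<partial>\<nu>) = \<dots>" .
  qed
  also have "\<dots> = (\<integral>\<^sup>+y. (\<Sum>z\<in>I. ennreal (w z y * c (z - y))) \<partial>M)"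
    by (rule nn_integral_sum[symmetric]) auto
  also have "\<dots> = (\<integral>\<^sup>+y. ennreal (\<Sum>z\<in>I. w z y * c (z - y)) \<partial>M)"
    using w_nonneg c by (simp add: sum_ennreal)
  finally show ?thesis .
qed

end

context quad_cost
begin

lemma cost_le_double: "c (x + y) \<le> 2 * c x + 2 * c y"
  using cost_split[of 1 x y] by simp

lemma integrable_cost_shift:
  assumes M: "prob_space M" and sets: "sets M = sets borel" and int: "integrable M c"
  shows "integrable M (\<lambda>y. c (z - y))"
proof (rule Bochner_Integration.integrable_bound)
  interpret prob_space M by fact
  show "integrable M (\<lambda>y. 2 * c z + 2 * c y)" using int by simp
  show "(\<lambda>y. c (z - y)) \<in> borel_measurable M"
    by (simp add: measurable_cong_sets[OF sets refl])
  show "AE y in M. norm (c (z - y)) \<le> norm (2 * c z + 2 * c y)"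
  proof (rule AE_I2)
    fix y
    show "norm (c (z - y)) \<le> norm (2 * c z + 2 * c y)"
      using cost_le_double[of z "- y"] cost_nonneg[of "z - y"] cost_nonneg[of z] cost_nonneg[of y]
      unfolding cost_minus by simp
  qed
qed

lemma transport_cost_discretised:
  assumes "discretised \<nu> M S I w" and \<rho>: "0 < \<rho>"
    and int: "integrable \<nu> (\<lambda>x. c (x - S x))" and int': "integrable M (\<lambda>y. \<Sum>z\<in>I. w z y * c (z - y))"
  shows "transport_cost c \<nu> M \<le> ennreal ((1 + 1 / \<rho>) * (\<integral>x. c (x - S x) \<partial>\<nu>)
    + (1 + \<rho>) * (\<integral>y. (\<Sum>z\<in>I. w z y * c (z - y)) \<partial>M))"
proof -
  interpret discretised \<nu> M S I w by fact
  have [measurable]: "(\<lambda>p. ennreal (c (fst p - S (fst p)))) \<in> borel_measurable plan"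
    "(\<lambda>p. ennreal (c (S (fst p) - snd p))) \<in> borel_measurable plan"
    by (simp_all add: measurable_cong_sets[OF sets_plan refl])
  have fstm: "fst \<in> measurable plan borel"
    by (simp add: measurable_cong_sets[OF sets_plan refl])
  have "transport_cost c \<nu> M \<le> (\<integral>\<^sup>+p. ennreal (c (fst p - snd p)) \<partial>plan)"
    unfolding transport_cost_def by (rule INF_lower[OF plan_coupling])
  also have "\<dots> \<le> (\<integral>\<^sup>+p. ennreal (1 + 1 / \<rho>) * ennreal (c (fst p - S (fst p)))
      + ennreal (1 + \<rho>) * ennreal (c (S (fst p) - snd p)) \<partial>plan)"
  proof (rule nn_integral_mono)
    fix p :: "'a \<times> 'a"
    have "c (fst p - snd p) \<le> (1 + 1 / \<rho>) * c (fst p - S (fst p)) + (1 + \<rho>) * c (S (fst p) - snd p)"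
      using cost_split[OF \<rho>, of "fst p - S (fst p)" "S (fst p) - snd p"] by simp
    then have "ennreal (c (fst p - snd p))
        \<le> ennreal ((1 + 1 / \<rho>) * c (fst p - S (fst p)) + (1 + \<rho>) * c (S (fst p) - snd p))"
      by (rule ennreal_leI)
    also have "\<dots> = ennreal (1 + 1 / \<rho>) * ennreal (c (fst p - S (fst p)))
      + ennreal (1 + \<rho>) * ennreal (c (S (fst p) - snd p))"
      using \<rho> cost_nonneg by (subst ennreal_plus) (auto simp: ennreal_mult)
    finally show "ennreal (c (fst p - snd p)) \<le> \<dots>" .
  qed
  also have "\<dots> = ennreal (1 + 1 / \<rho>) * (\<integral>\<^sup>+p. ennreal (c (fst p - S (fst p))) \<partial>plan)
      + ennreal (1 + \<rho>) * (\<integral>\<^sup>+p. ennreal (c (S (fst p) - snd p)) \<partial>plan)"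
    by (simp add: nn_integral_add nn_integral_cmult)
  also have "(\<integral>\<^sup>+p. ennreal (c (fst p - S (fst p))) \<partial>plan) = (\<integral>\<^sup>+x. ennreal (c (x - S x)) \<partial>\<nu>)"
    by (subst (2) plan_fst[symmetric], subst nn_integral_distr[OF fstm]) auto
  also have "\<dots> = ennreal (\<integral>x. c (x - S x) \<partial>\<nu>)"
    by (rule nn_integral_eq_integral[OF int]) (simp add: cost_nonneg)
  also have "(\<integral>\<^sup>+p. ennreal (c (S (fst p) - snd p)) \<partial>plan) = (\<integral>\<^sup>+y. ennreal (\<Sum>z\<in>I. w z y * c (z - y)) \<partial>M)"
    by (rule plan_discrete_cost) (auto simp: cost_nonneg)
  also have "\<dots> = ennreal (\<integral>y. (\<Sum>z\<in>I. w z y * c (z - y)) \<partial>M)"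
    by (rule nn_integral_eq_integral[OF int']) (auto intro!: AE_I2 sum_nonneg simp: cost_nonneg w_nonneg)
  also have "ennreal (1 + 1 / \<rho>) * ennreal (\<integral>x. c (x - S x) \<partial>\<nu>)
      + ennreal (1 + \<rho>) * ennreal (\<integral>y. (\<Sum>z\<in>I. w z y * c (z - y)) \<partial>M)
    = ennreal ((1 + 1 / \<rho>) * (\<integral>x. c (x - S x) \<partial>\<nu>) + (1 + \<rho>) * (\<integral>y. (\<Sum>z\<in>I. w z y * c (z - y)) \<partial>M))"
  proof -
    have "0 \<le> (\<integral>x. c (x - S x) \<partial>\<nu>)" "0 \<le> (\<integral>y. (\<Sum>z\<in>I. w z y * c (z - y)) \<partial>M)"
      by (auto intro!: integral_nonneg_AE AE_I2 sum_nonneg simp: cost_nonneg w_nonneg)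
    then show ?thesis using \<rho> by (subst ennreal_plus) (auto simp: ennreal_mult)
  qed
  finally show ?thesis .
qed

text \<open>
  Simple functions \<open>F n\<close> converge to the identity pointwise. Where \<open>c (x - F n x)\<close> is not small yet, the
  value \<open>0\<close> is used instead, so that the error is dominated by the integrable function \<open>1 + c x\<close>.
\<close>

lemma finite_range_approximation:
  assumes \<nu>: "prob_space \<nu>" and sets: "sets \<nu> = sets borel" and int: "integrable \<nu> c" and \<eta>: "0 < \<eta>"
  obtains S where "S \<in> borel_measurable borel" "finite (range S)"
    "integrable \<nu> (\<lambda>x. c (x - S x))" "(\<integral>x. c (x - S x) \<partial>\<nu>) \<le> \<eta>"
proof -
  interpret prob_space \<nu> by fact
  have m: "f \<in> borel_measurable borel \<Longrightarrow> f \<in> borel_measurable \<nu>" for f :: "'a \<Rightarrow> real"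
    by (simp add: measurable_cong_sets[OF sets refl])
  obtain F :: "nat \<Rightarrow> 'a \<Rightarrow> 'a" where F: "\<And>n. simple_function borel (F n)"
    and lim: "\<And>x. (\<lambda>n. F n x) \<longlonglongrightarrow> x"
    using borel_measurable_implies_sequence_metric[of "\<lambda>x::'a. x" borel 0] by auto
  have [measurable]: "F n \<in> borel_measurable borel" for n
    using F by (rule borel_measurable_simple_function)
  define S where "S n x = (if c (x - F n x) \<le> 1 then F n x else 0)" for n x
  have [measurable]: "S n \<in> borel_measurable borel" for n
    unfolding S_def[abs_def] by measurable
  have finS: "finite (range (S n))" for n
  proof (rule finite_subset)
    show "range (S n) \<subseteq> insert 0 (range (F n))" by (auto simp: S_def)
    show "finite (insert 0 (range (F n)))" using F[of n] by (simp add: simple_function_def)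
  qed
  have bound: "norm (c (x - S n x)) \<le> 1 + c x" for n x
    using cost_nonneg[of x] cost_nonneg[of "x - F n x"] by (simp add: S_def)
  have intS: "integrable \<nu> (\<lambda>x. c (x - S n x))" for n
    by (rule Bochner_Integration.integrable_bound[of _ "\<lambda>x. 1 + c x"])
      (use int bound in \<open>auto intro!: m AE_I2 order_trans[OF _ abs_ge_self]\<close>)
  have "(\<lambda>n. \<integral>x. c (x - S n x) \<partial>\<nu>) \<longlonglongrightarrow> (\<integral>x. 0 \<partial>\<nu>)"
  proof (rule integral_dominated_convergence[where w = "\<lambda>x. 1 + c x"])
    show "AE x in \<nu>. (\<lambda>n. c (x - S n x)) \<longlonglongrightarrow> 0"
    proof (rule AE_I2)
      fix x
      have "(\<lambda>n. c (x - F n x)) \<longlonglongrightarrow> c (x - x)"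
        by (rule continuous_on_tendsto_compose[OF cost_cont tendsto_diff[OF tendsto_const lim]]) auto
      then have conv: "(\<lambda>n. c (x - F n x)) \<longlonglongrightarrow> 0" by (simp add: cost_zero)
      then have "eventually (\<lambda>n. c (x - F n x) < 1) sequentially"
        by (rule order_tendstoD) simp
      then have "eventually (\<lambda>n. c (x - F n x) = c (x - S n x)) sequentially"
        by eventually_elim (simp add: S_def)
      then show "(\<lambda>n. c (x - S n x)) \<longlonglongrightarrow> 0" using conv by (rule Lim_transform_eventually[rotated])
    qed
  qed (use int bound in \<open>auto intro!: m\<close>)
  then have "(\<lambda>n. \<integral>x. c (x - S n x) \<partial>\<nu>) \<longlonglongrightarrow> 0" by simp
  then have "eventually (\<lambda>n. (\<integral>x. c (x - S n x) \<partial>\<nu>) < \<eta>) sequentially"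
    by (rule order_tendstoD) (rule \<eta>)
  then obtain n where "(\<integral>x. c (x - S n x) \<partial>\<nu>) < \<eta>" by (auto simp: eventually_sequentially)
  then show thesis by (intro that[of "S n"] finS intS) auto
qed

end

section \<open>The transport inequality from the restricted logarithmic Sobolev inequality\<close>

lemma integral_simple_cells:
  fixes S :: "'a::euclidean_space \<Rightarrow> 'a" and h :: "'a \<Rightarrow> real"
  assumes "prob_space \<nu>" "sets \<nu> = sets borel" and [measurable]: "S \<in> borel_measurable borel"
  shows "integrable \<nu> (\<lambda>x. \<Sum>z\<in>I. h z * indicator (S -` {z}) x)"
    and "(\<integral>x. (\<Sum>z\<in>I. h z * indicator (S -` {z}) x) \<partial>\<nu>) = (\<Sum>z\<in>I. measure \<nu> (S -` {z}) * h z)"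
proof -
  interpret prob_space \<nu> by fact
  have sp: "space \<nu> = UNIV" using sets_eq_imp_space_eq[OF assms(2)] by simp
  have cell: "S -` {z} \<in> sets \<nu>" for z
    using measurable_sets[OF assms(3), of "{z}"] assms(2) by simp
  have i: "integrable \<nu> (\<lambda>x. h z * indicator (S -` {z}) x)" for z
    using cell by (intro integrable_mult_right integrable_real_indicator) (auto simp: less_top[symmetric])
  then show "integrable \<nu> (\<lambda>x. \<Sum>z\<in>I. h z * indicator (S -` {z}) x)"
    by (intro Bochner_Integration.integrable_sum) auto
  show "(\<integral>x. (\<Sum>z\<in>I. h z * indicator (S -` {z}) x) \<partial>\<nu>) = (\<Sum>z\<in>I. measure \<nu> (S -` {z}) * h z)"
    using i by (subst Bochner_Integration.integral_sum) (auto simp: sp mult.commute)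
qed

context quad_cost
begin

text \<open>
  Let \<open>G\<close> be the envelope of the heights \<open>h z\<close> at the points \<open>z \<in> I\<close>, truncated at \<open>m\<close>. At a point \<open>x\<close> the
  steep envelope with \<open>\<theta> \<le> 4\<close> is at least \<open>h (S x) - 4 * c (x - S x)\<close>. Its mean under \<open>\<nu>\<close> is bounded by the
  entropy and the logarithmic Laplace transform (Donsker and Varadhan), and the latter by the mean of
  the envelope with \<open>\<theta> = 1\<close>, which is the one occurring in the dual of the transport problem.
\<close>

lemma dual_bound_truncated:
  assumes M: "borel_prob M" and C: "0 < C" and E: "1 \<le> E"
    and L: "restricted_lsi c (1 / (2 * C)) (2 * E) M"
    and \<nu>: "borel_prob \<nu>" and H: "relative_entropy \<nu> M = ereal H"
    and I: "finite I" "I \<noteq> {}"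
    and S [measurable]: "S \<in> borel_measurable borel" and S_in: "AE x in \<nu>. S x \<in> I"
    and intS: "integrable \<nu> (\<lambda>x. c (x - S x))"
  shows "(\<Sum>z\<in>I. measure \<nu> (S -` {z}) * h z) \<le> (\<integral>y. max m (MAX z\<in>I. h z - c (z - y)) \<partial>M)
    + (8 * C * E * H + 4 * (\<integral>x. c (x - S x) \<partial>\<nu>))"
proof -
  have PM: "prob_space M" and setsM: "sets M = sets borel"
    and P\<nu>: "prob_space \<nu>" and sets\<nu>: "sets \<nu> = sets borel"
    using M \<nu> by (auto simp: borel_prob_def)
  interpret F: cost_family c "insert None (Some ` I)" "case_option m h"
    "case_option (\<lambda>_. 0) (\<lambda>z y. c (z - y))" None
  proof
    fix i x y and \<rho> :: real
    assume "i \<in> insert None (Some ` I)" and \<rho>: "0 < \<rho>"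
    show "case_option (\<lambda>_. 0) (\<lambda>z y. c (z - y)) i y
      \<le> (1 + 1 / \<rho>) * case_option (\<lambda>_. 0) (\<lambda>z y. c (z - y)) i x + (1 + \<rho>) * c (x - y)"
    proof (cases i)
      case None
      then show ?thesis using \<rho> cost_nonneg[of "x - y"] by simp
    next
      case (Some z)
      then show ?thesis using cost_split[OF \<rho>, of "z - x" "x - y"] by simp
    qed
  qed (use I cost_nonneg in auto)
  have env1: "F.env 1 y = max m (MAX z\<in>I. h z - c (z - y))" for y
    unfolding F.env_def using I by (simp add: image_image)
  define g where "g x = (\<Sum>z\<in>I. h z * indicator (S -` {z}) x)" for x
  have g_int: "integrable \<nu> g" and g_eq: "(\<integral>x. g x \<partial>\<nu>) = (\<Sum>z\<in>I. measure \<nu> (S -` {z}) * h z)"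
    unfolding g_def using integral_simple_cells[OF P\<nu> sets\<nu> S] by blast+
  have g_S: "g x = h (S x)" if "S x \<in> I" for x
  proof -
    have "g x = (\<Sum>z\<in>I. if z = S x then h z else 0)"
      unfolding g_def by (intro sum.cong) (auto split: split_indicator)
    then show ?thesis using that I by simp
  qed
  let ?D = "\<integral>x. c (x - S x) \<partial>\<nu>" and ?X = "\<integral>y. F.env 1 y \<partial>M"
  have bound: "(\<integral>x. g x \<partial>\<nu>) \<le> H / (a * (1 - a) / (2 * C * E)) + ?X + 4 * ?D"
    if a: "1 / 2 < a" "a < 1" for a
  proof -
    define k where "k = a * (1 - a) / (2 * C * E)"
    define \<theta> where "\<theta> = 1 / a\<^sup>2"
    have k: "0 < k" unfolding k_def using a C E by simp
    have "(1 / 2)\<^sup>2 \<le> a\<^sup>2" using a by (intro power_mono) auto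
    then have \<theta>: "0 \<le> \<theta>" "\<theta> \<le> 4" using a by (auto simp: \<theta>_def power2_eq_square divide_simps)
    have bd: "bounded (range (F.env \<theta>))" by (rule F.env_bounded[OF \<theta>(1)])
    then have bdk: "bounded (range (\<lambda>x. k * F.env \<theta> x))"
      by (intro bounded_range_mult) auto
    have e\<nu>: "integrable \<nu> (F.env \<theta>)"
      by (rule integrable_bounded_range[OF P\<nu> _ bd]) (simp add: measurable_cong_sets[OF sets\<nu> refl])
    have "(\<integral>x. g x \<partial>\<nu>) \<le> (\<integral>x. F.env \<theta> x + 4 * c (x - S x) \<partial>\<nu>)"
    proof (rule integral_mono_AE[OF g_int])
      show "AE x in \<nu>. g x \<le> F.env \<theta> x + 4 * c (x - S x)"
        using S_in
      proof eventually_elim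
        case (elim x)
        have "h (S x) - \<theta> * c (S x - x) \<le> F.env \<theta> x"
          using F.env_ge[of "Some (S x)" \<theta> x] elim by simp
        moreover have "c (S x - x) = c (x - S x)" using cost_minus[of "x - S x"] by simp
        moreover have "\<theta> * c (x - S x) \<le> 4 * c (x - S x)"
          using \<theta> cost_nonneg by (intro mult_right_mono) auto
        ultimately show ?case using g_S[OF elim] by simp
      qed
    qed (use e\<nu> intS in auto)
    also have "\<dots> = (\<integral>x. F.env \<theta> x \<partial>\<nu>) + 4 * ?D" using e\<nu> intS by simp
    also have "(\<integral>x. F.env \<theta> x \<partial>\<nu>) \<le> H / k + ?X"
    proof -
      have "(\<integral>x. k * F.env \<theta> x \<partial>\<nu>) \<le> H + ln (\<integral>x. exp (k * F.env \<theta> x) \<partial>M)"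
        by (rule donsker_varadhan[OF PM P\<nu> _ _ bdk H])
          (simp_all add: sets\<nu> setsM measurable_cong_sets[OF setsM refl])
      then have "(\<integral>x. F.env \<theta> x \<partial>\<nu>) \<le> H / k + F.log_laplace M k \<theta>"
        using k by (simp add: F.log_laplace_def field_simps)
      also have "F.log_laplace M k \<theta> \<le> ?X"
        unfolding k_def \<theta>_def by (rule F.log_laplace_le_integral[OF M C E L a])
      finally show ?thesis by simp
    qed
    finally show ?thesis unfolding k_def by simp
  qed
  \<comment> \<open>The curve is degenerate at \<open>a = 1/2\<close>, so the optimal constant is reached as a limit.\<close>
  have "(\<integral>x. g x \<partial>\<nu>) \<le> H / (1 / 2 * (1 - 1 / 2) / (2 * C * E)) + ?X + 4 * ?D"
  proof (rule tendsto_lowerbound)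
    show "((\<lambda>a. H / (a * (1 - a) / (2 * C * E)) + ?X + 4 * ?D)
      \<longlongrightarrow> H / (1 / 2 * (1 - 1 / 2) / (2 * C * E)) + ?X + 4 * ?D) (at_right (1 / 2))"
      using C E by (intro tendsto_intros) auto
    have "eventually (\<lambda>a. a \<in> {1 / 2<..<1}) (at_right (1 / 2 :: real))"
      by (rule eventually_at_right_real) simp
    then show "eventually (\<lambda>a. (\<integral>x. g x \<partial>\<nu>) \<le> H / (a * (1 - a) / (2 * C * E)) + ?X + 4 * ?D) (at_right (1 / 2))"
      by eventually_elim (rule bound; simp)
  qed simp
  then show ?thesis unfolding g_eq env1 by (simp add: mult_ac)
qed

text \<open>
  Let the truncation height \<open>m = - n\<close> tend to \<open>- \<infinity>\<close>; integrability of the cost gives domination.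
\<close>

lemma dual_bound:
  assumes M: "borel_prob M" and C: "0 < C" and E: "1 \<le> E"
    and L: "restricted_lsi c (1 / (2 * C)) (2 * E) M"
    and \<nu>: "borel_prob \<nu>" and H: "relative_entropy \<nu> M = ereal H"
    and I: "finite I" "I \<noteq> {}"
    and S: "S \<in> borel_measurable borel" and S_in: "AE x in \<nu>. S x \<in> I"
    and intS: "integrable \<nu> (\<lambda>x. c (x - S x))" and intM: "integrable M c"
  shows "(\<Sum>z\<in>I. measure \<nu> (S -` {z}) * h z) \<le> (\<integral>y. (MAX z\<in>I. h z - c (z - y)) \<partial>M)
    + (8 * C * E * H + 4 * (\<integral>x. c (x - S x) \<partial>\<nu>))"
proof (rule LIMSEQ_le_const)
  have PM: "prob_space M" and setsM: "sets M = sets borel"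
    using M by (auto simp: borel_prob_def)
  interpret prob_space M by fact
  let ?X = "\<lambda>y. MAX z\<in>I. h z - c (z - y)"
  have X: "integrable M ?X"
    using I integrable_cost_shift[OF PM setsM intM] by (intro integrable_MAX) auto
  have "(\<lambda>n. \<integral>y. max (- real n) (?X y) \<partial>M) \<longlonglongrightarrow> (\<integral>y. ?X y \<partial>M)"
  proof (rule integral_dominated_convergence[where w = "\<lambda>y. \<bar>?X y\<bar>"])
    show "AE y in M. (\<lambda>n. max (- real n) (?X y)) \<longlonglongrightarrow> ?X y"
    proof (rule AE_I2, rule tendsto_eventually)
      fix y
      obtain N :: nat where "- ?X y \<le> real N" using real_arch_simple by blast
      then show "eventually (\<lambda>n. max (- real n) (?X y) = ?X y) sequentially"
        by (intro eventually_sequentiallyI[of N]) (simp add: max_def)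
    qed
    show "AE y in M. norm (max (- real n) (?X y)) \<le> \<bar>?X y\<bar>" for n by (intro AE_I2) auto
  qed (use X in auto)
  then show "(\<lambda>n. (\<integral>y. max (- real n) (?X y) \<partial>M) + (8 * C * E * H + 4 * (\<integral>x. c (x - S x) \<partial>\<nu>)))
    \<longlonglongrightarrow> (\<integral>y. ?X y \<partial>M) + (8 * C * E * H + 4 * (\<integral>x. c (x - S x) \<partial>\<nu>))"
    by (intro tendsto_intros)
  show "\<exists>N. \<forall>n\<ge>N. (\<Sum>z\<in>I. measure \<nu> (S -` {z}) * h z) \<le> (\<integral>y. max (- real n) (?X y) \<partial>M)
      + (8 * C * E * H + 4 * (\<integral>x. c (x - S x) \<partial>\<nu>))"
    using dual_bound_truncated[OF M C E L \<nu> H I S S_in intS] by blast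
qed

text \<open>
  The dual bound holds for all heights, so duality provides a coupling of the discretised \<open>\<nu>\<close> with \<open>M\<close>
  whose cost exceeds \<open>8 C E H\<close> by at most a multiple of the discretisation error. Only atoms of
  positive mass are kept. Undoing the discretisation uses the splitting inequality with parameter \<open>\<rho>\<close>.
\<close>

lemma approximate_transport:
  assumes M: "borel_prob M" and C: "0 < C" and E: "1 \<le> E"
    and L: "restricted_lsi c (1 / (2 * C)) (2 * E) M"
    and \<nu>: "borel_prob \<nu>" and H: "relative_entropy \<nu> M = ereal H"
    and intM: "integrable M c" and int\<nu>: "integrable \<nu> c"
    and \<rho>: "0 < \<rho>" and \<eta>: "0 < \<eta>"
  obtains X where "0 \<le> X" "X \<le> (1 + 1 / \<rho>) * \<eta> + (1 + \<rho>) * (8 * C * E * H + 5 * \<eta>)"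
    "transport_cost c \<nu> M \<le> ennreal X"
proof -
  have PM: "prob_space M" and setsM: "sets M = sets borel"
    and P\<nu>: "prob_space \<nu>" and sets\<nu>: "sets \<nu> = sets borel"
    using M \<nu> by (auto simp: borel_prob_def)
  interpret M: prob_space M by fact
  interpret N: prob_space \<nu> by fact
  have sp: "space \<nu> = UNIV" using sets_eq_imp_space_eq[OF sets\<nu>] by simp
  obtain S where S: "S \<in> borel_measurable borel" and finS: "finite (range S)"
    and intS: "integrable \<nu> (\<lambda>x. c (x - S x))" and small: "(\<integral>x. c (x - S x) \<partial>\<nu>) \<le> \<eta>"
    by (rule finite_range_approximation[OF P\<nu> sets\<nu> int\<nu> \<eta>])
  have cell: "S -` {z} \<in> sets \<nu>" for z
    using measurable_sets[OF S, of "{z}"] sets\<nu> by simp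
  define I where "I = {z \<in> range S. 0 < measure \<nu> (S -` {z})}"
  have I: "finite I" using finS by (auto simp: I_def)
  have "AE x in \<nu>. \<forall>z\<in>range S - I. S x \<noteq> z"
  proof (rule AE_finite_allI)
    fix z assume "z \<in> range S - I"
    then have "measure \<nu> (S -` {z}) = 0" by (auto simp: I_def zero_less_measure_iff)
    then have "AE x in \<nu>. x \<notin> S -` {z}" using cell by (simp add: N.prob_eq_0)
    then show "AE x in \<nu>. S x \<noteq> z" by eventually_elim auto
  qed (use finS in auto)
  then have S_in: "AE x in \<nu>. S x \<in> I" by eventually_elim auto
  have I_ne: "I \<noteq> {}" using S_in N.AE_False by auto
  define a where "a z = measure \<nu> (S -` {z})" for z
  have sum_a: "sum a I = 1"
  proof -
    have "sum a I = (\<integral>x. (\<Sum>z\<in>I. 1 * indicator (S -` {z}) x) \<partial>\<nu>)"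
      unfolding integral_simple_cells(2)[OF P\<nu> sets\<nu> S] by (simp add: a_def)
    also have "\<dots> = (\<integral>x. 1 \<partial>\<nu>)"
    proof (rule integral_cong_AE)
      show "AE x in \<nu>. (\<Sum>z\<in>I. 1 * indicator (S -` {z}) x) = (1::real)"
        using S_in
      proof eventually_elim
        case (elim x)
        have "(\<Sum>z\<in>I. 1 * indicator (S -` {z}) x) = (\<Sum>z\<in>I. if z = S x then 1 else 0 :: real)"
          by (intro sum.cong) (auto split: split_indicator)
        then show ?case using elim I by simp
      qed
    qed (use cell in auto)
    finally show ?thesis using N.prob_space by simp
  qed
  define \<epsilon> where "\<epsilon> = \<eta> / card I"
  have card: "0 < card I" using I I_ne by (simp add: card_gt_0_iff)
  interpret D: semidiscrete M I a "\<lambda>z y. c (z - y)" \<epsilon>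
    by unfold_locales
      (use I I_ne sum_a integrable_cost_shift[OF PM setsM intM] cost_nonneg \<eta> card in
        \<open>auto simp: \<epsilon>_def a_def I_def\<close>)
  obtain w where w: "\<And>i. i \<in> I \<Longrightarrow> w i \<in> borel_measurable M" "\<And>i y. 0 \<le> w i y"
    "\<And>y. (\<Sum>i\<in>I. w i y) = 1" "\<And>i y. i \<in> I \<Longrightarrow> w i y \<le> 1"
    "\<And>i. i \<in> I \<Longrightarrow> (\<integral>y. w i y \<partial>M) = a i"
    and cost: "(\<integral>y. (\<Sum>i\<in>I. w i y * c (i - y)) \<partial>M)
      \<le> (8 * C * E * H + 4 * (\<integral>x. c (x - S x) \<partial>\<nu>)) + \<epsilon> * card I"
    using D.semidiscrete_duality[OF dual_bound[OF M C E L \<nu> H I I_ne S S_in intS intM, folded a_def]]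
    by blast
  have wc: "integrable M (\<lambda>y. w z y * c (z - y))" if z: "z \<in> I" for z
  proof (rule Bochner_Integration.integrable_bound[OF integrable_cost_shift[OF PM setsM intM, of z]])
    show "(\<lambda>y. w z y * c (z - y)) \<in> borel_measurable M"
      using w(1)[OF z] D.b_measurable[OF z] by simp
    show "AE y in M. norm (w z y * c (z - y)) \<le> norm (c (z - y))"
      using w(2,4) z cost_nonneg by (intro AE_I2) (simp add: abs_mult mult_left_le_one_le)
  qed
  have wi: "integrable M (w z)" if z: "z \<in> I" for z
    using w(1,2,4) z by (intro M.integrable_const_bound[of _ 1]) auto
  have disc: "discretised \<nu> M S I w"
    by unfold_locales
      (use w wi S S_in I sets\<nu> setsM in \<open>auto simp: a_def I_def measurable_cong_sets[OF setsM refl]\<close>)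
  define X where "X = (1 + 1 / \<rho>) * (\<integral>x. c (x - S x) \<partial>\<nu>)
      + (1 + \<rho>) * (\<integral>y. (\<Sum>z\<in>I. w z y * c (z - y)) \<partial>M)"
  show thesis
  proof (rule that)
    show "transport_cost c \<nu> M \<le> ennreal X"
      unfolding X_def by (rule transport_cost_discretised[OF disc \<rho> intS]) (use wc in auto)
    show "0 \<le> X"
      unfolding X_def using \<rho> w(2)
      by (auto intro!: add_nonneg_nonneg mult_nonneg_nonneg integral_nonneg_AE AE_I2 sum_nonneg cost_nonneg)
    have "(\<integral>y. (\<Sum>z\<in>I. w z y * c (z - y)) \<partial>M) \<le> 8 * C * E * H + 5 * \<eta>"
      using cost small card by (simp add: \<epsilon>_def)
    then show "X \<le> (1 + 1 / \<rho>) * \<eta> + (1 + \<rho>) * (8 * C * E * H + 5 * \<eta>)"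
      unfolding X_def using small \<rho> by (intro add_mono mult_left_mono) auto
  qed
qed

text \<open>
  Let \<open>\<rho>\<close> and the discretisation error \<open>\<eta> = \<rho>\<^sup>2\<close> tend to \<open>0\<close> together; the square compensates the factor
  \<open>1 + 1/\<rho>\<close>.
\<close>

lemma transport_cost_le_entropy:
  assumes M: "borel_prob M" and C: "0 < C" and E: "1 \<le> E"
    and L: "restricted_lsi c (1 / (2 * C)) (2 * E) M"
    and \<nu>: "borel_prob \<nu>" and H: "relative_entropy \<nu> M = ereal H"
    and intM: "integrable M c" and int\<nu>: "integrable \<nu> c"
  shows "enn2ereal (transport_cost c \<nu> M) \<le> ereal (8 * C * E * H)"
proof -
  have fin: "transport_cost c \<nu> M \<noteq> \<infinity>"
    by (rule approximate_transport[OF assms, of 1 1]) (auto simp: top_unique)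
  then obtain t where t: "transport_cost c \<nu> M = ennreal t" "0 \<le> t"
    by (cases "transport_cost c \<nu> M") auto
  have bound: "t \<le> \<rho>\<^sup>2 + \<rho> + (1 + \<rho>) * (8 * C * E * H + 5 * \<rho>\<^sup>2)" if \<rho>: "0 < \<rho>" for \<rho>
  proof -
    obtain X where "0 \<le> X" "X \<le> (1 + 1 / \<rho>) * \<rho>\<^sup>2 + (1 + \<rho>) * (8 * C * E * H + 5 * \<rho>\<^sup>2)"
      "transport_cost c \<nu> M \<le> ennreal X"
      by (rule approximate_transport[OF assms \<rho>, of "\<rho>\<^sup>2"]) (use \<rho> in auto)
    then have "t \<le> (1 + 1 / \<rho>) * \<rho>\<^sup>2 + (1 + \<rho>) * (8 * C * E * H + 5 * \<rho>\<^sup>2)"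
      using t by simp
    also have "(1 + 1 / \<rho>) * \<rho>\<^sup>2 = \<rho>\<^sup>2 + \<rho>" using \<rho> by (simp add: field_simps power2_eq_square)
    finally show ?thesis .
  qed
  have "t \<le> 8 * C * E * H"
  proof (rule tendsto_lowerbound)
    have "((\<lambda>\<rho>. \<rho>\<^sup>2 + \<rho> + (1 + \<rho>) * (8 * C * E * H + 5 * \<rho>\<^sup>2)) \<longlongrightarrow>
      0\<^sup>2 + 0 + (1 + 0) * (8 * C * E * H + 5 * 0\<^sup>2)) (at_right 0)"
      by (intro tendsto_intros)
    then show "((\<lambda>\<rho>. \<rho>\<^sup>2 + \<rho> + (1 + \<rho>) * (8 * C * E * H + 5 * \<rho>\<^sup>2)) \<longlongrightarrow> 8 * C * E * H) (at_right 0)"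
      by simp
    have "eventually (\<lambda>\<rho>::real. 0 < \<rho>) (at_right 0)" by (rule eventually_at_right_less)
    then show "eventually (\<lambda>\<rho>. t \<le> \<rho>\<^sup>2 + \<rho> + (1 + \<rho>) * (8 * C * E * H + 5 * \<rho>\<^sup>2)) (at_right 0)"
      by eventually_elim (rule bound)
  qed simp
  then show ?thesis unfolding t(1) using t(2) by simp
qed

section \<open>Integrability of the cost\<close>

lemma coupling_cost_integrable:
  assumes \<pi>: "\<pi> \<in> couplings \<nu> \<mu>" and int: "integrable \<pi> (\<lambda>z. c (fst z - snd z))"
  shows "integrable \<nu> c \<longleftrightarrow> integrable \<mu> c"
proof -
  have sets: "sets \<pi> = sets borel" using \<pi> by (auto simp: couplings_def borel_prob_def)
  have [measurable]: "(\<lambda>z. c (fst z)) \<in> borel_measurable \<pi>" "(\<lambda>z. c (snd z)) \<in> borel_measurable \<pi>"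
    by (simp_all add: measurable_cong_sets[OF sets refl])
  have b: "c (fst z) \<le> 2 * c (snd z) + 2 * c (fst z - snd z)"
    "c (snd z) \<le> 2 * c (fst z) + 2 * c (fst z - snd z)" for z
    using cost_le_double[of "snd z" "fst z - snd z"] cost_le_double[of "fst z" "- (fst z - snd z)"]
    unfolding cost_minus by simp_all
  have "integrable \<pi> (\<lambda>z. c (fst z)) \<longleftrightarrow> integrable \<pi> (\<lambda>z. c (snd z))"
  proof
    assume "integrable \<pi> (\<lambda>z. c (fst z))"
    then have "integrable \<pi> (\<lambda>z. 2 * c (fst z) + 2 * c (fst z - snd z))" using int by simp
    then show "integrable \<pi> (\<lambda>z. c (snd z))"
      by (rule Bochner_Integration.integrable_bound)
        (use b(2) cost_nonneg in \<open>auto intro!: AE_I2 order_trans[OF _ abs_ge_self]\<close>)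
  next
    assume "integrable \<pi> (\<lambda>z. c (snd z))"
    then have "integrable \<pi> (\<lambda>z. 2 * c (snd z) + 2 * c (fst z - snd z))" using int by simp
    then show "integrable \<pi> (\<lambda>z. c (fst z))"
      by (rule Bochner_Integration.integrable_bound)
        (use b(1) cost_nonneg in \<open>auto intro!: AE_I2 order_trans[OF _ abs_ge_self]\<close>)
  qed
  then show ?thesis by (simp add: coupling_fst(2)[OF \<pi>] coupling_snd(2)[OF \<pi>])
qed

lemma transport_ineq_integrable_iff:
  assumes T: "transport_ineq c C \<mu>" and \<nu>: "borel_prob \<nu>" and H: "relative_entropy \<nu> \<mu> = ereal H"
  shows "integrable \<nu> c \<longleftrightarrow> integrable \<mu> c"
proof -
  obtain \<pi> where "\<pi> \<in> couplings \<nu> \<mu>" "integrable \<pi> (\<lambda>z. c (fst z - snd z))"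
    by (rule transport_ineq_coupling[OF T \<nu> cost_measurable cost_nonneg H zero_less_one])
  then show ?thesis by (rule coupling_cost_integrable)
qed

text \<open>
  The tilt of \<open>\<mu>\<close> by \<open>- c\<close> has finite entropy and integrates \<open>c\<close>, because \<open>c e\<^bsup>- c\<^esup>\<close> is bounded. The
  transport inequality couples it with \<open>\<mu>\<close> at finite cost, which transfers integrability to \<open>\<mu>\<close>.
\<close>

lemma transport_ineq_integrable:
  assumes T: "transport_ineq c C \<mu>"
  shows "integrable \<mu> c"
proof -
  have P: "prob_space \<mu>" and sets: "sets \<mu> = sets borel"
    using T by (auto simp: transport_ineq_def borel_prob_def)
  interpret prob_space \<mu> by fact
  have [measurable]: "c \<in> borel_measurable \<mu>"
    by (simp add: measurable_cong_sets[OF sets refl])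
  have bd: "exp (- c x) * c x \<le> 1" for x
  proof -
    have "c x \<le> exp (c x)" using exp_ge_add_one_self[of "c x"] by linarith
    then show ?thesis by (simp add: exp_minus field_simps)
  qed
  have i: "integrable \<mu> (\<lambda>x. exp (- c x))" "integrable \<mu> (\<lambda>x. exp (- c x) * c x)"
    using bd cost_nonneg by (auto intro!: integrable_const_bound[of _ 1] AE_I2 simp: abs_mult)
  have N: "borel_prob (exp_tilt (\<lambda>x. - c x) \<mu>)"
    using prob_space_exp_tilt[OF P _ i(1)] by (simp add: borel_prob_def sets)
  have "relative_entropy (exp_tilt (\<lambda>x. - c x) \<mu>) \<mu>
    = ereal ((\<integral>x. - c x \<partial>exp_tilt (\<lambda>x. - c x) \<mu>) - ln (\<integral>x. exp (- c x) \<partial>\<mu>))"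
    by (rule relative_entropy_exp_tilt[OF P]) (use i in auto)
  moreover have "integrable (exp_tilt (\<lambda>x. - c x) \<mu>) c"
    by (rule exp_tilt_integrable) (use i in auto)
  ultimately show ?thesis using transport_ineq_integrable_iff[OF T N] by blast
qed

end

text \<open>
  The two densities differ by the factor \<open>e\<^sup>\<phi> / Z\<close>, whose logarithm is bounded.
\<close>

lemma finite_entropy_exp_tilt:
  fixes \<phi> :: "'a \<Rightarrow> real"
  assumes \<mu>: "prob_space \<mu>" and [measurable]: "\<phi> \<in> borel_measurable \<mu>" and b: "bounded (range \<phi>)"
    and \<nu>: "prob_space \<nu>" and sets: "sets \<nu> = sets \<mu>"
    and H: "relative_entropy \<nu> (exp_tilt \<phi> \<mu>) = ereal H"
  obtains H' where "relative_entropy \<nu> \<mu> = ereal H'"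
proof -
  have i: "integrable \<mu> (\<lambda>x. exp (\<phi> x))"
    by (intro integrable_bounded_range[OF \<mu>] bounded_range_exp b) simp
  let ?Z = "\<integral>x. exp (\<phi> x) \<partial>\<mu>"
  have Z: "0 < ?Z" by (rule integral_exp_pos[OF \<mu> i])
  have P: "prob_space (exp_tilt \<phi> \<mu>)" by (rule prob_space_exp_tilt[OF \<mu> _ i]) simp
  obtain q :: "'a \<Rightarrow> real" where q_meas: "q \<in> borel_measurable (exp_tilt \<phi> \<mu>)" and q0: "\<And>x. 0 \<le> q x"
    and dens: "\<nu> = density (exp_tilt \<phi> \<mu>) (\<lambda>x. ennreal (q x))" and int: "integrable \<nu> (\<lambda>x. ln (q x))"
    by (rule finite_relative_entropyE[OF P \<nu>]) (use H sets in auto)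
  have [measurable]: "q \<in> borel_measurable \<mu>"
    using q_meas measurable_cong_sets[OF sets_exp_tilt refl] by blast
  define r where "r x = exp (\<phi> x) / ?Z * q x" for x
  have [measurable]: "r \<in> borel_measurable \<mu>" unfolding r_def[abs_def] by measurable
  have r0: "0 \<le> r x" for x unfolding r_def using Z q0 by simp
  have \<nu>r: "\<nu> = density \<mu> (\<lambda>x. ennreal (r x))"
    unfolding dens exp_tilt_def Let_def r_def
    using Z q0 by (subst density_density_eq) (auto simp: ennreal_mult[symmetric])
  have [measurable]: "\<phi> \<in> borel_measurable \<nu>" "r \<in> borel_measurable \<nu>"
    by (simp_all add: measurable_cong_sets[OF sets refl])
  have "AE x in \<nu>. 0 < q x"
    unfolding dens using q_meas by (subst AE_density) auto
  then have eq: "AE x in \<nu>. \<phi> x - ln ?Z + ln (q x) = ln (r x)"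
    by eventually_elim (use Z in \<open>simp add: r_def ln_mult ln_div\<close>)
  have "integrable \<nu> (\<lambda>x. \<phi> x - ln ?Z + ln (q x))"
  proof -
    interpret prob_space \<nu> by fact
    show ?thesis using integrable_bounded_range[OF \<nu> _ b] int by simp
  qed
  then have "integrable \<nu> (\<lambda>x. ln (r x))"
    by (rule integrable_cong_AE_imp) (use eq in auto)
  then have "integrable (density \<mu> (\<lambda>x. ennreal (r x))) (\<lambda>x. ln (r x))"
    using \<nu>r by simp
  from relative_entropy_density[of \<mu> r, OF \<mu> _ r0 this] show thesis
    using that \<nu>r by simp
qed

theorem (in quad_cost) transport_ineq_exp_tilt:
  assumes T: "transport_ineq c C \<mu>" and C: "0 < C"
    and b: "bounded (range \<phi>)" and \<phi>: "\<phi> \<in> borel_measurable borel"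
  shows "transport_ineq c (8 * C * exp (osc \<phi>)) (exp_tilt \<phi> \<mu>)"
proof -
  have \<mu>: "borel_prob \<mu>" using T by (simp add: transport_ineq_def)
  then have P: "prob_space \<mu>" and sets: "sets \<mu> = sets borel" by (auto simp: borel_prob_def)
  have [measurable]: "\<phi> \<in> borel_measurable \<mu>" "c \<in> borel_measurable \<mu>"
    using \<phi> by (simp_all add: measurable_cong_sets[OF sets refl])
  let ?M = "exp_tilt \<phi> \<mu>" and ?E = "exp (osc \<phi>)"
  have i: "integrable \<mu> (\<lambda>x. exp (\<phi> x))"
    by (intro integrable_bounded_range[OF P] bounded_range_exp b) simp
  have M: "borel_prob ?M"
    using prob_space_exp_tilt[OF P _ i] by (simp add: borel_prob_def sets)
  have E: "1 \<le> ?E" using osc_bounds(3)[OF b] by simp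
  \<comment> \<open>With \<open>\<kappa> = 1 / (2 C)\<close> half of the entropy is absorbed, so the constant is \<open>2\<close>.\<close>
  have "restricted_lsi c (1 / (2 * C)) (1 / (1 - 1 / (2 * C) * C)) \<mu>"
    by (rule transport_ineq_imp_restricted_lsi[OF T]) (use C cost_nonneg in auto)
  then have "restricted_lsi c (1 / (2 * C)) 2 \<mu>" using C by simp
  then have L: "restricted_lsi c (1 / (2 * C)) (2 * ?E) ?M"
    by (intro restricted_lsi_exp_tilt \<mu> cost_zero \<phi> b) simp_all
  have int\<mu>: "integrable \<mu> c" by (rule transport_ineq_integrable[OF T])
  have intM: "integrable ?M c"
  proof (rule exp_tilt_integrable)
    show "integrable \<mu> (\<lambda>x. exp (\<phi> x) * c x)"
    proof (rule Bochner_Integration.integrable_bound)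
      show "integrable \<mu> (\<lambda>x. exp (SUP x. \<phi> x) * c x)" using int\<mu> by simp
      show "AE x in \<mu>. norm (exp (\<phi> x) * c x) \<le> norm (exp (SUP x. \<phi> x) * c x)"
        using osc_bounds(2)[OF b] cost_nonneg
        by (intro AE_I2) (simp add: abs_mult mult_right_mono)
    qed simp
  qed auto
  show ?thesis
    unfolding transport_ineq_def
  proof (intro conjI allI impI M)
    fix \<nu> :: "'a measure" assume \<nu>: "borel_prob \<nu>"
    then have P\<nu>: "prob_space \<nu>" and sets\<nu>: "sets \<nu> = sets borel" by (auto simp: borel_prob_def)
    show "enn2ereal (transport_cost c \<nu> ?M) \<le> ereal (8 * C * ?E) * relative_entropy \<nu> ?M"
    proof (cases "relative_entropy \<nu> ?M = \<infinity>")
      case True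
      then show ?thesis using C by simp
    next
      case False
      have PM: "prob_space ?M" and sets': "sets \<nu> = sets ?M" using M by (auto simp: borel_prob_def sets\<nu>)
      obtain H where H: "relative_entropy \<nu> ?M = ereal H"
        by (rule finite_relative_entropyE[OF PM P\<nu> sets' False])
      obtain H' where H': "relative_entropy \<nu> \<mu> = ereal H'"
        by (rule finite_entropy_exp_tilt[OF P _ b P\<nu> _ H]) (auto simp: sets\<nu> sets)
      have int\<nu>: "integrable \<nu> c"
        using transport_ineq_integrable_iff[OF T \<nu> H'] int\<mu> by simp
      show ?thesis
        using transport_cost_le_entropy[OF M C E L \<nu> H intM int\<nu>] by (simp add: H)
    qed
  qed
qed

section \<open>Separable costs with concave derivative\<close>

text \<open>
  Concavity and \<open>\<alpha>' 0 = 0\<close> give \<open>\<alpha>' (\<sigma> w) \<le> \<sigma> \<alpha>' w\<close> for \<open>w \<ge> 0\<close>; integrate this inequality from \<open>0\<close> to \<open>u\<close>.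
\<close>

lemma square_scaling_of_concave_deriv:
  fixes \<alpha> :: "real \<Rightarrow> real"
  assumes even: "\<And>t. \<alpha> (- t) = \<alpha> t" and diff: "\<And>t. \<alpha> differentiable at t"
    and \<alpha>0: "\<alpha> 0 = 0" and d0: "deriv \<alpha> 0 = 0" and conc: "concave_on {0..} (deriv \<alpha>)"
    and \<sigma>: "1 \<le> \<sigma>"
  shows "\<alpha> (\<sigma> * u) \<le> \<sigma>\<^sup>2 * \<alpha> u"
proof -
  have D: "(\<alpha> has_real_derivative deriv \<alpha> t) (at t)" for t
    using diff[of t] DERIV_deriv_iff_real_differentiable by blast
  have nonneg: "\<alpha> (\<sigma> * u) \<le> \<sigma>\<^sup>2 * \<alpha> u" if u: "0 \<le> u" for u
  proof -
    define g where "g w = \<sigma>\<^sup>2 * \<alpha> w - \<alpha> (\<sigma> * w)" for w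
    have "g 0 \<le> g u"
    proof (rule DERIV_nonneg_imp_nondecreasing[OF u])
      fix w assume w: "0 \<le> w" "w \<le> u"
      have "(1 - 1 / \<sigma>) * deriv \<alpha> 0 + 1 / \<sigma> * deriv \<alpha> (\<sigma> * w)
          \<le> deriv \<alpha> ((1 - 1 / \<sigma>) *\<^sub>R 0 + (1 / \<sigma>) *\<^sub>R (\<sigma> * w))"
        by (rule conc[unfolded concave_on_iff, THEN conjunct2, rule_format]) (use w \<sigma> in auto)
      then have "deriv \<alpha> (\<sigma> * w) \<le> \<sigma> * deriv \<alpha> w"
        using \<sigma> by (simp add: d0 pos_divide_le_eq mult.commute)
      then have "\<sigma> * deriv \<alpha> (\<sigma> * w) \<le> \<sigma> * (\<sigma> * deriv \<alpha> w)"
        using \<sigma> by (intro mult_left_mono) auto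
      then have "0 \<le> \<sigma>\<^sup>2 * deriv \<alpha> w - deriv \<alpha> (\<sigma> * w) * \<sigma>"
        by (simp add: power2_eq_square mult_ac)
      moreover have "(g has_real_derivative \<sigma>\<^sup>2 * deriv \<alpha> w - deriv \<alpha> (\<sigma> * w) * \<sigma>) (at w)"
      proof -
        have "((\<lambda>w. \<alpha> (\<sigma> * w)) has_real_derivative deriv \<alpha> (\<sigma> * w) * \<sigma>) (at w)"
          by (rule DERIV_chain2[OF D]) (auto intro!: derivative_eq_intros)
        then show ?thesis unfolding g_def
          by (intro DERIV_diff DERIV_cmult D)
      qed
      ultimately show "\<exists>y. (g has_real_derivative y) (at w) \<and> 0 \<le> y" by blast
    qed
    then show ?thesis by (simp add: g_def \<alpha>0)
  qed
  show ?thesis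
  proof (cases "0 \<le> u")
    case False
    then show ?thesis using nonneg[of "- u"] even[of u] even[of "\<sigma> * u"] by simp
  qed (rule nonneg)
qed

text \<open>
  Write \<open>u + v\<close> as the convex combination of \<open>p u\<close> and \<open>q v\<close> with weights \<open>1/p\<close> and \<open>1/q\<close>, where
  \<open>p = 1 + 1/\<rho>\<close> and \<open>q = 1 + \<rho>\<close> are conjugate exponents.
\<close>

lemma split_of_square_scaling:
  fixes \<alpha> :: "real \<Rightarrow> real"
  assumes conv: "convex_on UNIV \<alpha>" and scale: "\<And>\<sigma> u. 1 \<le> \<sigma> \<Longrightarrow> \<alpha> (\<sigma> * u) \<le> \<sigma>\<^sup>2 * \<alpha> u"
    and \<rho>: "0 < \<rho>"
  shows "\<alpha> (u + v) \<le> (1 + 1 / \<rho>) * \<alpha> u + (1 + \<rho>) * \<alpha> v"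
proof -
  define p where "p = 1 + 1 / \<rho>"
  define q where "q = 1 + \<rho>"
  have pq: "1 \<le> p" "1 \<le> q" "1 / p + 1 / q = 1"
    using \<rho> by (auto simp: p_def q_def field_simps)
  have "\<alpha> ((1 / p) *\<^sub>R (p * u) + (1 / q) *\<^sub>R (q * v)) \<le> 1 / p * \<alpha> (p * u) + 1 / q * \<alpha> (q * v)"
    by (rule conv[unfolded convex_on_def, THEN conjunct2, rule_format]) (use pq in auto)
  then have "\<alpha> (u + v) \<le> 1 / p * \<alpha> (p * u) + 1 / q * \<alpha> (q * v)" using pq by simp
  also have "\<dots> \<le> 1 / p * (p\<^sup>2 * \<alpha> u) + 1 / q * (q\<^sup>2 * \<alpha> v)"
    using pq by (intro add_mono mult_left_mono scale) auto
  also have "\<dots> = p * \<alpha> u + q * \<alpha> v" using pq by (simp add: power2_eq_square)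
  finally show ?thesis by (simp add: p_def q_def)
qed

theorem corollary1p7:
  fixes \<alpha> :: "real \<Rightarrow> real"
    and \<mu> :: "(real ^ 'k::finite) measure"
    and \<phi> :: "real ^ 'k \<Rightarrow> real"
    and C :: real
  assumes "\<And>t. \<alpha> t \<ge> 0"
    and "convex_on UNIV \<alpha>"
    and "\<And>t. \<alpha> (- t) = \<alpha> t"
    and "\<alpha> C1_differentiable_on UNIV"
    and "\<alpha> 0 = 0"
    and "deriv \<alpha> 0 = 0"
    and "concave_on {0..} (deriv \<alpha>)"
    and "borel_prob \<mu>"
    and "C > 0"
    and "transport_ineq (sum_cost \<alpha>) C \<mu>"
    and "bounded (range \<phi>)"
    and "\<phi> \<in> borel_measurable borel"
  shows "transport_ineq (sum_cost \<alpha>) (8 * C * exp (osc \<phi>)) (exp_tilt \<phi> \<mu>)"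
proof -
  have diff: "\<alpha> differentiable at t" for t
    using assms(4) by (simp add: C1_differentiable_on_eq)
  then have cont: "continuous_on UNIV \<alpha>"
    by (intro continuous_at_imp_continuous_on) (auto intro: differentiable_imp_continuous_within)
  note scale = square_scaling_of_concave_deriv[OF assms(3) diff assms(5-7)]
  interpret quad_cost "sum_cost \<alpha> :: real ^ 'k \<Rightarrow> real"
  proof
    show "continuous_on UNIV (sum_cost \<alpha> :: real ^ 'k \<Rightarrow> real)"
      unfolding sum_cost_def
      by (intro continuous_intros continuous_on_compose2[OF cont]) auto
    fix x y :: "real ^ 'k"
    show "0 \<le> sum_cost \<alpha> x" using assms(1) by (simp add: sum_cost_def sum_nonneg)
    show "sum_cost \<alpha> (- x) = sum_cost \<alpha> x" by (simp add: sum_cost_def assms(3))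
    show "sum_cost \<alpha> (x + y) \<le> (1 + 1 / \<rho>) * sum_cost \<alpha> x + (1 + \<rho>) * sum_cost \<alpha> y"
      if "0 < \<rho>" for \<rho>
      unfolding sum_cost_def sum_distrib_left sum.distrib[symmetric] vector_add_component
      by (intro sum_mono split_of_square_scaling[OF assms(2) scale that])
  qed (simp add: sum_cost_def assms(5))
  show ?thesis
    by (rule transport_ineq_exp_tilt[OF assms(10,9,11,12)])
qed

end
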